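(* The boundary driven independent random walkers process on $\mathbb{N}^V$ with generator $L=\sum_{i,j\in V}p(i,j)L_{ij}+\sum_{i\in V}c(i)L_i^{\alpha_i,\gamma_i}$ is Poisson intertwined with the boundary driven deterministic process on $[0,\infty)^V$ with generator $$\mathcal{L}=\sum_{i,j\in V}p(i,j)\mathcal{L}_{ij}+\sum_{i\in V}c(i)\mathcal{L}_i^{\alpha_i,\gamma_i},$$ i.e. $\mathcal{G}L=\mathcal{L}\mathcal{G}$ for the Poisson intertwiner $\mathcal{G}f(\zeta)=\int f(\eta)\big(\bigotimes_{i\in V}\pi_{\zeta_i}\big)(d\eta)$. As a consequence, when the boundary driven independent random walkers (semigroup $S(t)$) are started from the product Poisson measure $\bigotimes_{i\in V}\pi_{\zeta_i}$, $\zeta\in[0,\infty)^V$, then $$\Big(\bigotimes_{i\in V}\pi_{\zeta_i}\Big)S(t)=\bigotimes_{i\in V}\pi_{Z_i^\zeta(t)},$$ where $Z^\zeta(t)$ evolves according to the deterministic generator $\mathcal{L}$ with $Z^\zeta(0)=\zeta$. As a further consequence, the unique stationary measure of the boundary driven independent random walkers is the Poisson product measure $\bigotimes_{i\in V}\pi_{\zeta_i^*}$, where $\zeta^*$ is the unique fixed point of the deterministic system $Z^\zeta(t)$.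
   Context: $\mathbb{N}=\{0,1,2,\dots\}$. $V$ is a finite set, $p(i,j)=p(j,i)\ge 0$ ($i,j\in V$) are symmetric edge weights which are irreducible: any two vertices are joined by a finite path along which $p>0$. Sums $\sum_{i,j}$ run over ordered pairs of distinct vertices. $c(i)\ge0$ are constants with $c(i)>0$ for at least one $i$; $\alpha_i\ge0$, $\gamma_i>0$. $\pi_z$ is the Poisson distribution with parameter $z\ge0$. Independent random walkers generators: $L_{ij}$ acts on $(\eta_i,\eta_j)=(n_1,n_2)$ as $$L_{ij}f(n_1,n_2)=n_1\big(f(n_1-1,n_2+1)-f(n_1,n_2)\big)+n_2\big(f(n_1+1,n_2-1)-f(n_1,n_2)\big);$$ $L_i^{\alpha,\gamma}$ acts on $\eta_i=n$ as $L^{\alpha,\gamma}f(n)=\alpha\big(f(n+1)-f(n)\big)+\gamma n\big(f(n-1)-f(n)\big)$. Deterministic generators, with $\partial_i=\partial/\partial\zeta_i$: $\mathcal{L}_{ij}=-(\zeta_i-\zeta_j)(\partial_i-\partial_j)$ and $\mathcal{L}_i^{\alpha,\gamma}=(\alpha-\gamma\zeta_i)\partial_i$. Since $\mathcal{L}$ is a first order differential operator, the process it generates is the flow of a deterministic system of ODEs, $\frac{d}{dt}f(Z^\zeta(t))=(\mathcal{L}f)(Z^\zeta(t))$. The generator identity is understood for functions $f$ for which both sides are well defined. *)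

theory Defs
  imports "HOL-Analysis.Analysis" "HOL-Probability.Probability"
begin

text \<open>
  The vertex set is a finite type \<open>'v\<close>; configurations are functions \<open>'v \<Rightarrow> nat\<close> and the states of
  the deterministic process are vectors in \<open>real ^ 'v\<close> with nonnegative coordinates.
\<close>

definition orthant :: "(real ^ 'v) set" where
  "orthant = {\<zeta>. \<forall>i. 0 \<le> \<zeta> $ i}"


subsection \<open>Independent random walkers\<close>

text \<open>
  The truncated subtraction on \<^typ>\<open>nat\<close> is harmless: wherever it truncates, the term is multiplied
  by \<open>0\<close>. The edge operator is only used for \<open>i \<noteq> j\<close>.
\<close>

definition walk_edge :: "'v \<Rightarrow> 'v \<Rightarrow> (('v \<Rightarrow> nat) \<Rightarrow> real) \<Rightarrow> ('v \<Rightarrow> nat) \<Rightarrow> real" where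
  "walk_edge i j f \<eta> =
     real (\<eta> i) * (f (\<eta>(i := \<eta> i - 1, j := \<eta> j + 1)) - f \<eta>) +
     real (\<eta> j) * (f (\<eta>(i := \<eta> i + 1, j := \<eta> j - 1)) - f \<eta>)"

definition walk_site ::
  "real \<Rightarrow> real \<Rightarrow> 'v \<Rightarrow> (('v \<Rightarrow> nat) \<Rightarrow> real) \<Rightarrow> ('v \<Rightarrow> nat) \<Rightarrow> real" where
  "walk_site a g i f \<eta> =
     a * (f (\<eta>(i := \<eta> i + 1)) - f \<eta>) +
     g * real (\<eta> i) * (f (\<eta>(i := \<eta> i - 1)) - f \<eta>)"

definition walk_gen ::
  "('v::finite \<Rightarrow> 'v \<Rightarrow> real) \<Rightarrow> ('v \<Rightarrow> real) \<Rightarrow> ('v \<Rightarrow> real) \<Rightarrow> ('v \<Rightarrow> real) \<Rightarrow>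
   (('v \<Rightarrow> nat) \<Rightarrow> real) \<Rightarrow> ('v \<Rightarrow> nat) \<Rightarrow> real" where
  "walk_gen p c \<alpha> \<gamma> f \<eta> =
     (\<Sum>i\<in>UNIV. \<Sum>j\<in>UNIV - {i}. p i j * walk_edge i j f \<eta>) +
     (\<Sum>i\<in>UNIV. c i * walk_site (\<alpha> i) (\<gamma> i) i f \<eta>)"

text \<open>
  The process generated by \<open>L\<close> is represented by its transition kernels \<open>S t \<eta>\<close>, the law at time \<open>t\<close>
  when started from \<open>\<eta>\<close>; values at \<open>t < 0\<close> are irrelevant. Using \<open>pmf\<close> means that the process does
  not explode. The generator condition is pointwise, on bounded functions: this says that the
  kernels form the transition function whose jump rates are those of \<open>L\<close>.
\<close>

definition markov_semigroup_of ::
  "(('a \<Rightarrow> real) \<Rightarrow> 'a \<Rightarrow> real) \<Rightarrow> (real \<Rightarrow> 'a \<Rightarrow> 'a pmf) \<Rightarrow> bool" where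
  "markov_semigroup_of L S \<longleftrightarrow>
     (\<forall>\<eta>. S 0 \<eta> = return_pmf \<eta>) \<and>
     (\<forall>s\<ge>0. \<forall>t\<ge>0. \<forall>\<eta>. S (s + t) \<eta> = bind_pmf (S s \<eta>) (S t)) \<and>
     (\<forall>f \<eta>. bounded (range f) \<longrightarrow>
        ((\<lambda>t. measure_pmf.expectation (S t \<eta>) f) has_real_derivative L f \<eta>) (at 0 within {0..}))"

text \<open>The action \<open>\<mu> S(t)\<close> of the semigroup on a probability measure \<open>\<mu>\<close> is \<open>bind_pmf \<mu> (S t)\<close>.\<close>

definition stationary :: "(real \<Rightarrow> 'a \<Rightarrow> 'a pmf) \<Rightarrow> 'a pmf \<Rightarrow> bool" where
  "stationary S \<mu> \<longleftrightarrow> (\<forall>t\<ge>0. bind_pmf \<mu> (S t) = \<mu>)"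


subsection \<open>The deterministic process\<close>

text \<open>On the boundary of the orthant the partial derivatives are one-sided.\<close>

definition along :: "'v \<Rightarrow> real ^ 'v \<Rightarrow> (real ^ 'v \<Rightarrow> real) \<Rightarrow> real \<Rightarrow> real" where
  "along i \<zeta> h x = h (\<chi> k. if k = i then x else \<zeta> $ k)"

definition partial_deriv :: "'v \<Rightarrow> (real ^ 'v \<Rightarrow> real) \<Rightarrow> real ^ 'v \<Rightarrow> real" where
  "partial_deriv i h \<zeta> = vector_derivative (along i \<zeta> h) (at (\<zeta> $ i) within {0..})"

definition det_edge :: "'v \<Rightarrow> 'v \<Rightarrow> (real ^ 'v \<Rightarrow> real) \<Rightarrow> real ^ 'v \<Rightarrow> real" where
  "det_edge i j h \<zeta> = - (\<zeta> $ i - \<zeta> $ j) * (partial_deriv i h \<zeta> - partial_deriv j h \<zeta>)"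

definition det_site :: "real \<Rightarrow> real \<Rightarrow> 'v \<Rightarrow> (real ^ 'v \<Rightarrow> real) \<Rightarrow> real ^ 'v \<Rightarrow> real" where
  "det_site a g i h \<zeta> = (a - g * \<zeta> $ i) * partial_deriv i h \<zeta>"

definition det_gen ::
  "('v::finite \<Rightarrow> 'v \<Rightarrow> real) \<Rightarrow> ('v \<Rightarrow> real) \<Rightarrow> ('v \<Rightarrow> real) \<Rightarrow> ('v \<Rightarrow> real) \<Rightarrow>
   (real ^ 'v \<Rightarrow> real) \<Rightarrow> real ^ 'v \<Rightarrow> real" where
  "det_gen p c \<alpha> \<gamma> h \<zeta> =
     (\<Sum>i\<in>UNIV. \<Sum>j\<in>UNIV - {i}. p i j * det_edge i j h \<zeta>) +
     (\<Sum>i\<in>UNIV. c i * det_site (\<alpha> i) (\<gamma> i) i h \<zeta>)"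

text \<open>\<open>Z \<zeta> t\<close> is the state at time \<open>t \<ge> 0\<close> of the process started from \<open>\<zeta>\<close>.\<close>

definition deterministic_flow_of ::
  "((real ^ 'v \<Rightarrow> real) \<Rightarrow> real ^ 'v \<Rightarrow> real) \<Rightarrow> (real ^ 'v::finite \<Rightarrow> real \<Rightarrow> real ^ 'v) \<Rightarrow> bool" where
  "deterministic_flow_of D Z \<longleftrightarrow>
     (\<forall>\<zeta>\<in>orthant. Z \<zeta> 0 = \<zeta> \<and> (\<forall>t\<ge>0. Z \<zeta> t \<in> orthant) \<and>
        (\<forall>h. h differentiable_on orthant \<longrightarrow>
           (\<forall>t\<ge>0. ((\<lambda>s. h (Z \<zeta> s)) has_real_derivative D h (Z \<zeta> t)) (at t within {0..}))))"

definition fixed_point :: "(real ^ 'v \<Rightarrow> real \<Rightarrow> real ^ 'v) \<Rightarrow> real ^ 'v \<Rightarrow> bool" where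
  "fixed_point Z \<zeta> \<longleftrightarrow> \<zeta> \<in> orthant \<and> (\<forall>t\<ge>0. Z \<zeta> t = \<zeta>)"


subsection \<open>Poisson intertwining\<close>

text \<open>The library constant \<^const>\<open>poisson_pmf\<close> is only specified for positive parameters.\<close>

definition poisson :: "real \<Rightarrow> nat pmf" where
  "poisson z = (if z = 0 then return_pmf 0 else poisson_pmf z)"

definition poisson_product :: "real ^ 'v::finite \<Rightarrow> ('v \<Rightarrow> nat) pmf" where
  "poisson_product \<zeta> = Pi_pmf UNIV 0 (\<lambda>i. poisson (\<zeta> $ i))"

definition intertwiner :: "(('v::finite \<Rightarrow> nat) \<Rightarrow> real) \<Rightarrow> real ^ 'v \<Rightarrow> real" where
  "intertwiner f \<zeta> = measure_pmf.expectation (poisson_product \<zeta>) f"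

text \<open>
  For a first order differential operator \<open>D\<close>, both sides of
  \<open>intertwiner (L f) \<zeta> = D (intertwiner f) \<zeta>\<close> are well defined if \<open>L f\<close> is integrable, the
  intertwiner of \<open>f\<close> is defined near \<open>\<zeta>\<close> (relative to the orthant), and it has all partial
  derivatives at \<open>\<zeta>\<close>.
\<close>

definition both_sides_defined ::
  "((('v::finite \<Rightarrow> nat) \<Rightarrow> real) \<Rightarrow> ('v \<Rightarrow> nat) \<Rightarrow> real) \<Rightarrow> (('v \<Rightarrow> nat) \<Rightarrow> real) \<Rightarrow> real ^ 'v \<Rightarrow> bool" where
  "both_sides_defined L f \<zeta> \<longleftrightarrow>
     integrable (poisson_product \<zeta>) (L f) \<and>
     (\<exists>e>0. \<forall>\<xi>\<in>orthant. dist \<xi> \<zeta> < e \<longrightarrow> integrable (poisson_product \<xi>) f) \<and>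
     (\<forall>i. along i \<zeta> (intertwiner f) differentiable (at (\<zeta> $ i) within {0..}))"

definition poisson_intertwined ::
  "((('v::finite \<Rightarrow> nat) \<Rightarrow> real) \<Rightarrow> ('v \<Rightarrow> nat) \<Rightarrow> real) \<Rightarrow>
   ((real ^ 'v \<Rightarrow> real) \<Rightarrow> real ^ 'v \<Rightarrow> real) \<Rightarrow> bool" where
  "poisson_intertwined L D \<longleftrightarrow>
     (\<forall>f. \<forall>\<zeta>\<in>orthant. both_sides_defined L f \<zeta> \<longrightarrow>
        intertwiner (L f) \<zeta> = D (intertwiner f) \<zeta>)"

end

theory Submission
  imports Defs "HOL-Complex_Analysis.Cauchy_Integral_Formula"
begin

text \<open>
  The flow is affine: \<open>Z\<^sup>\<zeta>(t) = \<zeta>\<^sup>* + P\<^sub>t (\<zeta> - \<zeta>\<^sup>*)\<close>, where \<open>P\<^sub>t = exp (t A)\<close> is positive (by uniformization),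
  symmetric, and exponentially contracting because irreducibility and killing make \<open>A\<close> negative
  definite. By symmetry \<open>P\<^sub>t\<close> is also the killed one-particle
  semigroup, and the walkers started from \<open>\<eta>\<close> have at time \<open>t\<close> the generating function
  \<open>\<Prod>\<^sub>i (1 - (P\<^sub>t g)\<^sub>i)\<^bsup>\<eta>\<^sub>i\<^esup> exp (- \<langle>m(t), g\<rangle>)\<close> in \<open>1 - g\<close>, with \<open>m(t) = \<zeta>\<^sup>* - P\<^sub>t \<zeta>\<^sup>*\<close> accounting for immigration.
  Generating functions determine the laws, so the semigroup property, the propagation of Poisson
  products and the uniqueness of the stationary law (let \<open>t \<rightarrow> \<infinity>\<close>) are read off from this formula.
  That every semigroup with generator \<open>L\<close> is this one follows from a maximum principle for the
  backward equation, with the number of particles as Lyapunov function.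
\<close>

subsection \<open>Exponentials of linear maps\<close>

text \<open>The generator identity links only \<open>walk_gen\<close> and \<open>det_gen\<close>.
  The jump rates are unbounded, so it does not simply exponentiate to an identity of semigroups. It
  is proved on its own, by the Mecke identity, while semigroups are compared on the functions
  \<open>thinning g\<close>, whose intertwiner at \<zeta> is exp (- <\<zeta>, g>). The walkers act
  on g through the linear map \<open>P t\<close>, and the unit cube of admissible g is invariant
  because \<open>P\<close> is sub-Markov. On the walker side the obstacle is that
  \<open>markov_semigroup_of\<close> prescribes only a derivative at time 0, state by state. For
  uniqueness, the semigroup law turns it into a right derivative at every time, left continuity has
  to be supplied, and nothing is uniform over configurations: hence the Lyapunov function. For
  existence, a candidate generating function must be shown to belong to an actual law. Adding
  independent particles one at a time to Poisson immigrants does this, and the same recursion over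
  particles yields the generator.\<close>

definition lin_exp :: "('a \<Rightarrow> 'a) \<Rightarrow> real \<Rightarrow> 'a \<Rightarrow> 'a::euclidean_space" where
  "lin_exp B t x = (\<Sum>n. (t ^ n / fact n) *\<^sub>R (B ^^ n) x)"

lemma bounded_linear_funpow_norm_le:
  fixes B :: "'a::real_normed_vector \<Rightarrow> 'a"
  assumes "bounded_linear B"
  shows "norm ((B ^^ n) x) \<le> onorm B ^ n * norm x"
proof (induction n)
  case (Suc n)
  have "norm (B ((B ^^ n) x)) \<le> onorm B * norm ((B ^^ n) x)"
    by (rule onorm[OF assms])
  also have "\<dots> \<le> onorm B * (onorm B ^ n * norm x)"
    by (intro mult_left_mono Suc onorm_pos_le assms)
  finally show ?case by simp
qed simp

lemma summable_lin_exp: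
  fixes B :: "'a::banach \<Rightarrow> 'a"
  assumes "bounded_linear B"
  shows "summable (\<lambda>n. (t ^ n / fact n) *\<^sub>R (B ^^ n) x)"
proof (rule summable_comparison_test')
  show "summable (\<lambda>n. (inverse (fact n) * (\<bar>t\<bar> * onorm B) ^ n) * norm x)"
    by (intro summable_mult2 summable_exp)
  show "norm ((t ^ n / fact n) *\<^sub>R (B ^^ n) x) \<le> inverse (fact n) * (\<bar>t\<bar> * onorm B) ^ n * norm x" for n
    using mult_left_mono[OF bounded_linear_funpow_norm_le[OF assms, of n x], of "\<bar>t\<bar> ^ n / fact n"]
    by (simp add: power_abs abs_mult field_simps)
qed

lemma lin_exp_0 [simp]: "lin_exp B 0 x = x"
proof -
  have "lin_exp B 0 x = (\<Sum>n\<in>{0}. (0 ^ n / fact n) *\<^sub>R (B ^^ n) x)"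
    unfolding lin_exp_def by (rule suminf_finite) auto
  then show ?thesis by simp
qed

lemma lin_exp_linear_image:
  assumes "bounded_linear B" "bounded_linear h"
  shows "h (lin_exp B t x) = (\<Sum>n. (t ^ n / fact n) *\<^sub>R h ((B ^^ n) x))"
  unfolding lin_exp_def
  using bounded_linear.suminf[OF assms(2) summable_lin_exp[OF assms(1)]]
  by (simp add: linear_simps(5)[OF assms(2)])

lemma lin_exp_commute:
  assumes "bounded_linear B"
  shows "lin_exp B t (B x) = B (lin_exp B t x)"
  unfolding lin_exp_linear_image[OF assms assms]
  by (simp add: lin_exp_def flip: funpow_swap1)

text \<open>Each coordinate is an everywhere convergent power series in t, and termwise
  differentiation shifts the coefficients by one application of \<open>B\<close>.\<close>

lemma has_vector_derivative_lin_exp: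
  assumes B: "bounded_linear B"
  shows "((\<lambda>t. lin_exp B t x) has_vector_derivative B (lin_exp B t x)) (at t within S)"
proof -
  have "((\<lambda>t. lin_exp B t x \<bullet> b) has_real_derivative lin_exp B t (B x) \<bullet> b) (at t)" for b
  proof -
    have bl: "bounded_linear (\<lambda>y. y \<bullet> b)" by (rule bounded_linear_inner_left)
    define a where "a n = (B ^^ n) x \<bullet> b / fact n" for n
    have eq: "lin_exp B t x \<bullet> b = (\<Sum>n. a n * t ^ n)" for t
      by (subst lin_exp_linear_image[OF B bl]) (simp add: a_def mult_ac)
    have sm: "summable (\<lambda>n. a n * t ^ n)" for t
      using bounded_linear.summable[OF bl summable_lin_exp[OF B, of t x]] by (simp add: a_def mult_ac)
    have "((\<lambda>t. \<Sum>n. a n * t ^ n) has_real_derivative (\<Sum>n. diffs a n * t ^ n)) (at t)"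
      by (rule termdiffs_strong_converges_everywhere[OF sm])
    moreover have "diffs a n * t ^ n = (t ^ n / fact n) *\<^sub>R ((B ^^ n) (B x) \<bullet> b)" for n
      by (simp add: diffs_def a_def funpow_swap1 field_simps del: of_nat_Suc)
    then have "lin_exp B t (B x) \<bullet> b = (\<Sum>n. diffs a n * t ^ n)"
      by (simp only: lin_exp_linear_image[OF B bl])
    ultimately show ?thesis
      by (simp only: eq)
  qed
  then have "((\<lambda>t. lin_exp B t x) has_vector_derivative lin_exp B t (B x)) (at t)"
    unfolding has_vector_derivative_def has_derivative_componentwise_within[of "\<lambda>t. lin_exp B t x"]
    by (auto simp: has_field_derivative_def mult_commute_abs)
  then show ?thesis
    by (simp add: lin_exp_commute[OF B] has_vector_derivative_at_within)
qed

lemma orthant_lin_exp: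
  fixes B :: "real ^ 'v \<Rightarrow> real ^ 'v"
  assumes B: "bounded_linear B" and pos: "\<And>x. x \<in> orthant \<Longrightarrow> B x \<in> orthant"
    and "x \<in> orthant" "0 \<le> t"
  shows "lin_exp B t x \<in> orthant"
proof -
  have "(B ^^ n) x \<in> orthant" for n
    by (induction n) (use assms in auto)
  moreover have bl: "bounded_linear (\<lambda>y::real^'v. y $ i)" for i by (rule bounded_linear_vec_nth)
  ultimately show ?thesis
    using \<open>0 \<le> t\<close> bounded_linear.summable[OF bl summable_lin_exp[OF B, of t x]]
    by (auto simp: orthant_def lin_exp_linear_image[OF B bl] intro!: suminf_nonneg)
qed

lemma antimono_of_deriv_nonpos:
  fixes f :: "real \<Rightarrow> real"
  assumes "\<And>t. 0 \<le> t \<Longrightarrow> (f has_real_derivative f' t) (at t within {0..})"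
    and "\<And>t. 0 \<le> t \<Longrightarrow> f' t \<le> 0" and "0 \<le> s" "s \<le> t"
  shows "f t \<le> f s"
proof (rule DERIV_nonpos_imp_decreasing_open[OF \<open>s \<le> t\<close>])
  fix x assume "s < x" "x < t"
  then have "at x within {0..} = at x"
    using \<open>0 \<le> s\<close> by (intro at_within_interior) (auto simp: interior_Ici)
  then show "\<exists>y. DERIV f x :> y \<and> y \<le> 0"
    using assms(1)[of x] assms(2)[of x] \<open>0 \<le> s\<close> \<open>s < x\<close> by auto
next
  have "continuous_on {0..} f"
    using assms(1) by (auto intro!: DERIV_continuous_on)
  then show "continuous_on {s..t} f"
    by (rule continuous_on_subset) (use \<open>0 \<le> s\<close> in auto)
qed

subsection \<open>The one-particle semigroup and the deterministic flow\<close>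

locale boundary_walk =
  fixes p :: "'v::finite \<Rightarrow> 'v \<Rightarrow> real" and c \<alpha> \<gamma> :: "'v \<Rightarrow> real"
  assumes p_nonneg: "p i j \<ge> 0"
    and p_sym: "p i j = p j i"
    and irreducible: "(i, j) \<in> {(a, b). p a b > 0}\<^sup>*"
    and c_nonneg: "c i \<ge> 0"
    and c_pos: "\<exists>i. c i > 0"
    and \<alpha>_nonneg: "\<alpha> i \<ge> 0"
    and \<gamma>_pos: "\<gamma> i > 0"
begin

text \<open>The linear part of the vector field of the deterministic process. The factor 2 arises
  because sums over ordered pairs meet every edge twice, as (i, j) and as (j, i).\<close>

definition drift :: "real ^ 'v \<Rightarrow> real ^ 'v" where
  "drift x = (\<chi> i. (\<Sum>j\<in>UNIV - {i}. 2 * p i j * (x $ j - x $ i)) - c i * \<gamma> i * x $ i)"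

definition source :: "real ^ 'v" where
  "source = (\<chi> i. c i * \<alpha> i)"

lemma bounded_linear_drift: "bounded_linear drift"
  by (intro linear_conv_bounded_linear[THEN iffD1] linearI)
    (auto simp: drift_def vec_eq_iff algebra_simps sum.distrib sum_distrib_left sum_subtractf)

lemmas drift_linear = linear_simps[OF bounded_linear_drift]

lemma sum_offdiag_swap:
  fixes f :: "'v \<Rightarrow> 'v \<Rightarrow> real"
  shows "(\<Sum>i\<in>UNIV. \<Sum>j\<in>UNIV - {i}. f i j) = (\<Sum>i\<in>UNIV. \<Sum>j\<in>UNIV - {i}. f j i)"
proof -
  have *: "(\<Sum>j\<in>UNIV - {i}. g j) = (\<Sum>j\<in>UNIV. if i = j then 0 else g j)" for i and g :: "'v \<Rightarrow> real"
    by (rule sum.mono_neutral_cong_left) auto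
  show ?thesis
    unfolding * by (subst sum.swap) (simp add: eq_commute)
qed

text \<open>Summation by parts: adding the edge sum to its index-swapped form, with p symmetric,
  produces the Dirichlet form. Symmetry and sign of \<open>drift\<close> are both read off from
  it.\<close>

lemma drift_inner:
  "x \<bullet> drift y = - (\<Sum>i\<in>UNIV. \<Sum>j\<in>UNIV - {i}. p i j * ((x $ i - x $ j) * (y $ i - y $ j)))
    - (\<Sum>i\<in>UNIV. c i * \<gamma> i * x $ i * y $ i)"
proof -
  define S where "S = (\<Sum>i\<in>UNIV. \<Sum>j\<in>UNIV - {i}. p i j * x $ i * (y $ j - y $ i))"
  have "S = (\<Sum>i\<in>UNIV. \<Sum>j\<in>UNIV - {i}. p i j * x $ j * (y $ i - y $ j))"
    unfolding S_def by (subst sum_offdiag_swap) (simp add: p_sym)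
  then have "2 * S = S + (\<Sum>i\<in>UNIV. \<Sum>j\<in>UNIV - {i}. p i j * x $ j * (y $ i - y $ j))"
    by simp
  also have "\<dots> = - (\<Sum>i\<in>UNIV. \<Sum>j\<in>UNIV - {i}. p i j * ((x $ i - x $ j) * (y $ i - y $ j)))"
    unfolding S_def by (simp add: algebra_simps flip: sum.distrib sum_negf)
  finally have "2 * S = \<dots>" .
  moreover have "x \<bullet> drift y = 2 * S - (\<Sum>i\<in>UNIV. c i * \<gamma> i * x $ i * y $ i)"
    by (simp add: inner_vec_def drift_def S_def sum_distrib_left sum_subtractf sum.distrib algebra_simps)
  ultimately show ?thesis by simp
qed

lemma drift_inner_commute: "x \<bullet> drift y = drift x \<bullet> y"
  by (subst (2) inner_commute) (simp add: drift_inner mult_ac)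

text \<open>If the form vanished at x, the edge terms would make x equal across every edge with p >
  0, hence constant by irreducibility, and the killing term at a vertex with c > 0 would make this
  constant 0.\<close>

lemma drift_inner_neg:
  assumes "x \<noteq> 0"
  shows "x \<bullet> drift x < 0"
proof (rule ccontr)
  assume nonneg: "\<not> x \<bullet> drift x < 0"
  define E where "E i j = p i j * ((x $ i - x $ j) * (x $ i - x $ j))" for i j
  define K where "K i = c i * \<gamma> i * x $ i * x $ i" for i
  have E: "E i j \<ge> 0" for i j by (simp add: E_def p_nonneg)
  have K: "K i \<ge> 0" for i
    using c_nonneg[of i] \<gamma>_pos[of i] by (simp add: K_def mult.assoc)
  have "0 \<le> (\<Sum>i\<in>UNIV. \<Sum>j\<in>UNIV - {i}. E i j)" "0 \<le> (\<Sum>i\<in>UNIV. K i)"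
    by (auto intro!: sum_nonneg E K)
  moreover have "x \<bullet> drift x = - (\<Sum>i\<in>UNIV. \<Sum>j\<in>UNIV - {i}. E i j) - (\<Sum>i\<in>UNIV. K i)"
    unfolding drift_inner E_def K_def ..
  ultimately have "(\<Sum>i\<in>UNIV. \<Sum>j\<in>UNIV - {i}. E i j) = 0" "(\<Sum>i\<in>UNIV. K i) = 0"
    using nonneg by linarith+
  then have E0: "i \<noteq> j \<Longrightarrow> E i j = 0" and K0: "K i = 0" for i j
    using E K by (auto simp: sum_nonneg_eq_0_iff sum_nonneg)
  obtain k where "c k > 0" using c_pos by blast
  then have "x $ k = 0"
    using K0[of k] \<gamma>_pos[of k] by (simp add: K_def)
  moreover have "x $ i = x $ k" for i
    using irreducible[of i k]
  proof (induction rule: rtrancl_induct)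
    case (step y z)
    then show ?case
      using E0[of y z] by (cases "y = z") (auto simp: E_def)
  qed simp
  ultimately show False
    using assms by (simp add: vec_eq_iff)
qed

text \<open>Compactness of the unit sphere turns strict negativity into a uniform spectral gap, and
  homogeneity of degree two extends it to all vectors.\<close>

lemma drift_coercive: "\<exists>\<delta>>0. \<forall>x. x \<bullet> drift x \<le> - \<delta> * (norm x)\<^sup>2"
proof -
  have cont: "continuous_on (sphere 0 1) (\<lambda>x. x \<bullet> drift x)"
    by (intro continuous_intros linear_continuous_on bounded_linear_drift)
  have "axis undefined 1 \<in> sphere (0 :: real ^ 'v) 1" by simp
  then have "sphere (0 :: real ^ 'v) 1 \<noteq> {}" by blast
  then obtain u :: "real ^ 'v" where u: "u \<in> sphere 0 1"
    "\<And>x. x \<in> sphere 0 1 \<Longrightarrow> x \<bullet> drift x \<le> u \<bullet> drift u"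
    using continuous_attains_sup[OF compact_sphere _ cont] by blast
  have "x \<bullet> drift x \<le> (u \<bullet> drift u) * (norm x)\<^sup>2" for x
  proof (cases "x = 0")
    case False
    define y where "y = (1 / norm x) *\<^sub>R x"
    have "x = norm x *\<^sub>R y" "norm y = 1" using False by (auto simp: y_def)
    then have "x \<bullet> drift x = (norm x)\<^sup>2 * (y \<bullet> drift y)"
      by (metis drift_linear(5) inner_scaleR_left inner_scaleR_right mult.assoc power2_eq_square)
    also have "\<dots> \<le> (norm x)\<^sup>2 * (u \<bullet> drift u)"
      using u(2)[of y] \<open>norm y = 1\<close> by (intro mult_left_mono) auto
    finally show ?thesis by (simp add: mult.commute)
  qed (simp add: drift_linear)
  moreover have "u \<bullet> drift u < 0" using u(1) by (intro drift_inner_neg) auto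
  ultimately show ?thesis by (intro exI[of _ "- (u \<bullet> drift u)"]) auto
qed

definition rate :: real where
  "rate = (SOME \<delta>. \<delta> > 0 \<and> (\<forall>x. x \<bullet> drift x \<le> - \<delta> * (norm x)\<^sup>2))"

lemma rate_pos: "rate > 0" and drift_inner_le: "x \<bullet> drift x \<le> - rate * (norm x)\<^sup>2"
  using someI_ex[OF drift_coercive] unfolding rate_def by auto

text \<open>The energy exp (2 * rate * t) * |x(t)|^2 is nonincreasing. Applied to a difference of
  solutions this gives uniqueness for the linear equation; applied to \<open>P\<close> it gives
  decay.\<close>

lemma norm_drift_solution_le:
  assumes "\<And>t. 0 \<le> t \<Longrightarrow> (x has_vector_derivative drift (x t)) (at t within {0..})" and "0 \<le> t"
  shows "norm (x t) \<le> exp (- rate * t) * norm (x 0)"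
proof -
  define f where "f t = exp (2 * rate * t) * (x t \<bullet> x t)" for t
  have "f t \<le> f 0"
  proof (rule antimono_of_deriv_nonpos[where f = f and s = 0 and t = t and f' =
        "\<lambda>t. exp (2 * rate * t) * (2 * (rate * (norm (x t))\<^sup>2 + x t \<bullet> drift (x t)))"])
    fix t :: real assume t: "0 \<le> t"
    have d: "((\<lambda>t. x t \<bullet> x t) has_real_derivative 2 * (x t \<bullet> drift (x t))) (at t within {0..})"
      using has_derivative_inner[OF assms(1)[OF t, unfolded has_vector_derivative_def]
          assms(1)[OF t, unfolded has_vector_derivative_def]]
      unfolding has_field_derivative_def
      by (rule has_derivative_eq_rhs) (simp add: fun_eq_iff inner_commute)
    have "((\<lambda>t. exp (2 * rate * t)) has_real_derivative 2 * rate * exp (2 * rate * t)) (at t within {0..})"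
      by (auto intro!: derivative_eq_intros)
    from DERIV_mult[OF this d] show "(f has_real_derivative exp (2 * rate * t) * (2 * (rate * (norm (x t))\<^sup>2 + x t \<bullet> drift (x t)))) (at t within {0..})"
      unfolding f_def
      by (rule DERIV_cong) (simp add: power2_norm_eq_inner algebra_simps)
    show "exp (2 * rate * t) * (2 * (rate * (norm (x t))\<^sup>2 + x t \<bullet> drift (x t))) \<le> 0"
      using drift_inner_le[of "x t"] by (simp add: mult_le_0_iff)
  qed (use assms in auto)
  moreover have "exp (2 * rate * t) = (exp (rate * t))\<^sup>2"
    by (simp add: mult.assoc exp_double)
  ultimately have "(exp (rate * t) * norm (x t))\<^sup>2 \<le> (norm (x 0))\<^sup>2"
    by (simp add: f_def power_mult_distrib power2_norm_eq_inner)
  then have "exp (rate * t) * norm (x t) \<le> norm (x 0)"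
    by (rule power2_le_imp_le) simp
  then show ?thesis
    by (simp add: exp_minus field_simps)
qed

lemma drift_solution_unique:
  assumes "\<And>t. 0 \<le> t \<Longrightarrow> (x has_vector_derivative drift (x t)) (at t within {0..})"
    and "\<And>t. 0 \<le> t \<Longrightarrow> (y has_vector_derivative drift (y t)) (at t within {0..})"
    and "x 0 = y 0" "0 \<le> t"
  shows "x t = y t"
proof -
  have "norm ((\<lambda>t. x t - y t) t) \<le> exp (- rate * t) * norm (x 0 - y 0)"
    by (rule norm_drift_solution_le) (use assms in \<open>auto simp: drift_linear intro!: derivative_intros\<close>)
  then show ?thesis using assms(3) by simp
qed

text \<open>Despite the name, this is the total exit rate from i, with the jumps to other vertices
  included: minus the diagonal entry of \<open>drift\<close>.\<close>

definition killing_rate :: "'v \<Rightarrow> real" where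
  "killing_rate i = (\<Sum>j\<in>UNIV - {i}. 2 * p i j) + c i * \<gamma> i"

text \<open>A uniformization constant: it dominates every exit rate, so that adding
  \<open>unif\<close> times the identity makes all matrix entries of \<open>drift\<close>
  nonnegative.\<close>

definition unif :: real where
  "unif = (\<Sum>i\<in>UNIV. killing_rate i)"

text \<open>This is exp (t drift). The scalar shift by \<open>unif\<close> is split off so that the
  remaining series has only positivity preserving terms.\<close>

definition P :: "real \<Rightarrow> real ^ 'v \<Rightarrow> real ^ 'v" where
  "P t x = exp (- unif * t) *\<^sub>R lin_exp (\<lambda>x. drift x + unif *\<^sub>R x) t x"

lemma bounded_linear_unif: "bounded_linear (\<lambda>x. drift x + unif *\<^sub>R x)"
  by (intro bounded_linear_add bounded_linear_drift bounded_linear_scaleR_right)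

lemma P_0 [simp]: "P 0 x = x"
  by (simp add: P_def)

lemma has_vector_derivative_P [derivative_intros]:
  "((\<lambda>t. P t x) has_vector_derivative drift (P t x)) (at t within S)"
proof -
  have "((\<lambda>t. exp (- unif * t)) has_real_derivative - unif * exp (- unif * t)) (at t within S)"
    by (auto intro!: derivative_eq_intros)
  from has_vector_derivative_scaleR[OF this has_vector_derivative_lin_exp[OF bounded_linear_unif, of x t S]]
  show ?thesis
    by (simp add: P_def drift_linear algebra_simps)
qed

lemma unif_step_orthant:
  assumes "x \<in> orthant"
  shows "drift x + unif *\<^sub>R x \<in> orthant"
proof -
  have kill: "killing_rate i \<ge> 0" for i
    using c_nonneg[of i] \<gamma>_pos[of i] by (simp add: killing_rate_def sum_nonneg p_nonneg)
  have "0 \<le> (drift x + unif *\<^sub>R x) $ i" for i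
  proof -
    have "killing_rate i \<le> unif"
      unfolding unif_def by (intro member_le_sum kill) auto
    then have "0 \<le> (unif - killing_rate i) * x $ i + (\<Sum>j\<in>UNIV - {i}. 2 * p i j * x $ j)"
      using assms by (intro add_nonneg_nonneg sum_nonneg mult_nonneg_nonneg p_nonneg) (auto simp: orthant_def)
    then show ?thesis
      by (simp add: drift_def killing_rate_def algebra_simps sum_subtractf sum_distrib_left)
  qed
  then show ?thesis by (simp add: orthant_def)
qed

lemma P_orthant: "x \<in> orthant \<Longrightarrow> 0 \<le> t \<Longrightarrow> P t x \<in> orthant"
  using orthant_lin_exp[OF bounded_linear_unif unif_step_orthant, of x t]
  by (simp add: P_def orthant_def)

text \<open>The source of the algebra of \<open>P\<close> below: the semigroup law, linearity and
  commutation with \<open>drift\<close> hold because both sides solve the same equation with the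
  same initial value.\<close>

lemma drift_solution_eq_P:
  assumes "\<And>t. 0 \<le> t \<Longrightarrow> (x has_vector_derivative drift (x t)) (at t within {0..})" and "0 \<le> t"
  shows "x t = P t (x 0)"
  by (rule drift_solution_unique) (use assms in \<open>auto intro: has_vector_derivative_P\<close>)

lemma P_add:
  assumes "0 \<le> s" "0 \<le> t"
  shows "P (s + t) x = P s (P t x)"
proof -
  have "((\<lambda>s. P (s + t) x) has_vector_derivative drift (P (s + t) x)) (at s within {0..})" for s
  proof -
    have "((\<lambda>s. s + t) has_vector_derivative 1) (at s within {0..})"
      by (auto simp flip: has_real_derivative_iff_has_vector_derivative intro!: derivative_eq_intros)
    from vector_diff_chain_within[OF this has_vector_derivative_P, of x] show ?thesis
      by (simp add: o_def)
  qed
  from drift_solution_eq_P[OF this \<open>0 \<le> s\<close>] show ?thesis by simp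
qed

lemma P_plus: "0 \<le> t \<Longrightarrow> P t (x + y) = P t x + P t y"
  using drift_solution_eq_P[of "\<lambda>t. P t x + P t y" t]
  by (simp add: drift_linear has_vector_derivative_add has_vector_derivative_P)

lemma P_scaleR: "0 \<le> t \<Longrightarrow> P t (a *\<^sub>R x) = a *\<^sub>R P t x"
  using drift_solution_eq_P[of "\<lambda>t. a *\<^sub>R P t x" t]
  by (simp add: drift_linear has_vector_derivative_P bounded_linear.has_vector_derivative[OF bounded_linear_scaleR_right])

lemma P_minus: "0 \<le> t \<Longrightarrow> P t (- x) = - P t x"
  using P_scaleR[of t "-1" x] by simp

lemma P_diff: "0 \<le> t \<Longrightarrow> P t (x - y) = P t x - P t y"
  using P_plus[of t x "- y"] by (simp add: P_minus)

lemma P_drift: "0 \<le> t \<Longrightarrow> P t (drift x) = drift (P t x)"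
  using drift_solution_eq_P[of "\<lambda>t. drift (P t x)" t]
  by (simp add: has_vector_derivative_P bounded_linear.has_vector_derivative[OF bounded_linear_drift])

text \<open>By symmetry of \<open>drift\<close> the pairing of \<open>P s x\<close> with
  \<open>P (t - s) y\<close> does not depend on s; its values at s = t and s = 0 are the two
  sides.\<close>

lemma P_inner: "P t x \<bullet> y = x \<bullet> P t y"
proof -
  define f where "f s = P s x \<bullet> P (t - s) y" for s
  have "(f has_real_derivative 0) (at s)" for s
  proof -
    have "((\<lambda>s. P (t - s) y) has_vector_derivative - drift (P (t - s) y)) (at s)"
    proof -
      have "((\<lambda>s. t - s) has_vector_derivative - 1) (at s)"
        by (auto simp flip: has_real_derivative_iff_has_vector_derivative intro!: derivative_eq_intros)
      from vector_diff_chain_within[OF this has_vector_derivative_P, of y] show ?thesis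
        by (simp add: o_def)
    qed
    from has_derivative_inner[OF has_vector_derivative_P[of x s UNIV, unfolded has_vector_derivative_def]
          this[unfolded has_vector_derivative_def]]
    show ?thesis
      unfolding has_field_derivative_def f_def
      by (rule has_derivative_eq_rhs) (simp add: fun_eq_iff drift_inner_commute)
  qed
  then have "f t = f 0" using DERIV_isconst_all by blast
  then show ?thesis by (simp add: f_def)
qed

text \<open>The derivative of \<open>P t x\<close> is \<open>P t (drift x)\<close>, which stays
  nonpositive because \<open>P\<close> preserves positivity. The vector 1 gives the sub-Markov
  property, and \<open>equilibrium\<close> the positivity of \<open>immigrants\<close>.\<close>

lemma P_superharmonic:
  assumes "- drift x \<in> orthant" "0 \<le> t"
  shows "P t x $ i \<le> x $ i"
proof -
  have "(\<lambda>t. P t x $ i) t \<le> (\<lambda>t. P t x $ i) 0"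
  proof (rule antimono_of_deriv_nonpos[where f = "\<lambda>t. P t x $ i" and s = 0 and t = t and f' = "\<lambda>s. drift (P s x) $ i"])
    fix s :: real assume "0 \<le> s"
    show "((\<lambda>t. P t x $ i) has_real_derivative drift (P s x) $ i) (at s within {0..})"
      unfolding has_real_derivative_iff_has_vector_derivative
      by (rule bounded_linear.has_vector_derivative[OF bounded_linear_vec_nth has_vector_derivative_P])
    show "drift (P s x) $ i \<le> 0"
      using P_orthant[OF assms(1) \<open>0 \<le> s\<close>] \<open>0 \<le> s\<close> by (simp add: P_minus P_drift orthant_def)
  qed (use assms in auto)
  then show ?thesis by simp
qed

lemma P_tendsto_0: "((\<lambda>t. P t x) \<longlongrightarrow> 0) at_top"
proof (rule Lim_null_comparison)
  show "\<forall>\<^sub>F t in at_top. norm (P t x) \<le> exp (- rate * t) * norm x"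
    using eventually_ge_at_top[of 0]
    by eventually_elim (use norm_drift_solution_le[of "\<lambda>t. P t x"] in \<open>auto intro: has_vector_derivative_P\<close>)
  have "((\<lambda>t. exp (- rate * t) * norm x) \<longlongrightarrow> 0 * norm x) at_top"
    using rate_pos
    by (intro tendsto_mult_right filterlim_compose[OF exp_at_bot]
        filterlim_tendsto_neg_mult_at_bot[OF tendsto_const _ filterlim_ident]) simp
  then show "((\<lambda>t. exp (- rate * t) * norm x) \<longlongrightarrow> 0) at_top" by simp
qed

section \<open>Equilibrium and the intensity of immigrants\<close>

definition equilibrium :: "real ^ 'v" where
  "equilibrium = (SOME x. drift x = - source)"

lemma drift_equilibrium: "drift equilibrium = - source"
proof -
  have "linear drift" using bounded_linear_drift by (rule bounded_linear.linear)
  moreover have "inj drift"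
    using drift_inner_neg by (force simp: linear_injective_0[OF \<open>linear drift\<close>])
  ultimately have "surj drift" by (rule linear_inj_imp_surj)
  then have "\<exists>x. drift x = - source" by (metis surjD)
  then show ?thesis unfolding equilibrium_def by (rule someI_ex)
qed

lemma source_orthant: "source \<in> orthant"
  by (simp add: orthant_def source_def c_nonneg \<alpha>_nonneg)

text \<open>The integral of \<open>P s source\<close> over s from 0 to t, in closed form: the mean
  numbers of particles present at time t that entered after time 0.\<close>

definition immigrants :: "real \<Rightarrow> real ^ 'v" where
  "immigrants t = equilibrium - P t equilibrium"

lemma immigrants_orthant: "0 \<le> t \<Longrightarrow> immigrants t \<in> orthant"
  using P_superharmonic[of equilibrium t] source_orthant
  by (simp add: immigrants_def drift_equilibrium orthant_def)

lemma immigrants_0 [simp]: "immigrants 0 = 0"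
  by (simp add: immigrants_def)

text \<open>Particles entering during the first s units of time evolve for t more; the later ones
  contribute \<open>immigrants t\<close>.\<close>

lemma immigrants_add:
  "0 \<le> s \<Longrightarrow> 0 \<le> t \<Longrightarrow> immigrants (s + t) = P t (immigrants s) + immigrants t"
  by (subst (1) add.commute) (simp add: immigrants_def P_diff P_add)

lemma immigrants_tendsto: "(immigrants \<longlongrightarrow> equilibrium) at_top"
  unfolding immigrants_def using tendsto_diff[OF tendsto_const P_tendsto_0, of equilibrium] by simp

text \<open>Nonnegativity is inherited from \<open>immigrants t\<close>, which converges to
  \<open>equilibrium\<close>.\<close>

lemma equilibrium_orthant: "equilibrium \<in> orthant"
proof -
  have "0 \<le> equilibrium $ i" for i
  proof (rule tendsto_lowerbound)
    show "((\<lambda>t. immigrants t $ i) \<longlongrightarrow> equilibrium $ i) at_top"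
      by (intro tendsto_vec_nth immigrants_tendsto)
    show "\<forall>\<^sub>F t in at_top. 0 \<le> immigrants t $ i"
      using eventually_ge_at_top[of 0]
      by eventually_elim (use immigrants_orthant in \<open>auto simp: orthant_def\<close>)
  qed simp
  then show ?thesis by (simp add: orthant_def)
qed

lemma P_cube:
  assumes "g \<in> {0..1}" "0 \<le> t"
  shows "P t g \<in> {0..1}"
proof -
  \<comment> \<open>On the constant vector 1 all jump terms cancel, and only the killing - c i *
    \<gamma> i remains.\<close>
  have "- drift 1 \<in> orthant"
    using c_nonneg \<gamma>_pos by (simp add: orthant_def drift_def less_imp_le)
  then have "P t 1 $ i \<le> 1" for i
    using P_superharmonic[OF _ \<open>0 \<le> t\<close>, of 1 i] by simp
  moreover have "g \<in> orthant" "1 - g \<in> orthant"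
    using assms(1) by (auto simp: orthant_def less_eq_vec_def)
  then have "P t g \<in> orthant" "P t (1 - g) \<in> orthant"
    using \<open>0 \<le> t\<close> by (auto intro: P_orthant)
  ultimately show ?thesis
    using \<open>0 \<le> t\<close> by (auto simp: orthant_def less_eq_vec_def P_diff intro: order_trans)
qed

section \<open>The deterministic generator as a vector field, and its flow\<close>

lemma det_gen_eq:
  "det_gen p c \<alpha> \<gamma> h \<zeta> = (\<Sum>i\<in>UNIV. (drift \<zeta> + source) $ i * partial_deriv i h \<zeta>)"
proof -
  let ?d = "\<lambda>i. partial_deriv i h \<zeta>"
  have "(\<Sum>i\<in>UNIV. \<Sum>j\<in>UNIV - {i}. p i j * det_edge i j h \<zeta>) =
      (\<Sum>i\<in>UNIV. \<Sum>j\<in>UNIV - {i}. p i j * (\<zeta> $ j - \<zeta> $ i) * ?d i) +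
      (\<Sum>i\<in>UNIV. \<Sum>j\<in>UNIV - {i}. p i j * (\<zeta> $ i - \<zeta> $ j) * ?d j)"
    by (simp add: det_edge_def algebra_simps flip: sum.distrib)
  also have "(\<Sum>i\<in>UNIV. \<Sum>j\<in>UNIV - {i}. p i j * (\<zeta> $ i - \<zeta> $ j) * ?d j) =
      (\<Sum>i\<in>UNIV. \<Sum>j\<in>UNIV - {i}. p i j * (\<zeta> $ j - \<zeta> $ i) * ?d i)"
    by (subst sum_offdiag_swap) (simp add: p_sym)
  finally have "(\<Sum>i\<in>UNIV. \<Sum>j\<in>UNIV - {i}. p i j * det_edge i j h \<zeta>) =
      (\<Sum>i\<in>UNIV. (\<Sum>j\<in>UNIV - {i}. 2 * p i j * (\<zeta> $ j - \<zeta> $ i)) * ?d i)"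
    by (simp add: sum_distrib_left sum_distrib_right mult.assoc flip: mult_2)
  then show ?thesis
    by (simp add: det_gen_def det_site_def drift_def source_def algebra_simps flip: sum.distrib)
qed

end

lemma at_within_Ici_neq_bot:
  fixes x :: real
  assumes "a \<le> x"
  shows "at x within {a..} \<noteq> bot"
proof -
  have "x islimpt {x<..<x + 1}" by (rule islimpt_greaterThanLessThan1) simp
  then have "x islimpt {a..}" by (rule islimpt_subset) (use assms in auto)
  then show ?thesis by (simp add: trivial_limit_within)
qed

text \<open>The coordinate ray through \<zeta> stays in the orthant, so a derivative relative to the
  orthant restricts to it. This covers boundary points, where the partial derivative is
  one-sided.\<close>

lemma partial_deriv_eq:
  fixes \<zeta> :: "real ^ 'v::finite"
  assumes h: "(h has_derivative h') (at \<zeta> within orthant)" and \<zeta>: "\<zeta> \<in> orthant"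
  shows "partial_deriv i h \<zeta> = h' (axis i 1)"
proof -
  define g where "g x = (\<chi> k. if k = i then x else \<zeta> $ k)" for x
  have g_eq: "g x = \<zeta> + (x - \<zeta> $ i) *\<^sub>R axis i 1" for x
    by (simp add: g_def vec_eq_iff axis_def)
  have g\<zeta>: "g (\<zeta> $ i) = \<zeta>" by (simp add: g_eq)
  have "(g has_derivative (\<lambda>d. d *\<^sub>R axis i 1)) (at (\<zeta> $ i) within {0..})"
    unfolding g_eq by (auto intro!: derivative_eq_intros)
  moreover have "(h has_derivative h') (at (g (\<zeta> $ i)) within g ` {0..})"
    unfolding g\<zeta> by (rule has_derivative_subset[OF h]) (use \<zeta> in \<open>auto simp: orthant_def g_def\<close>)
  ultimately have "((h \<circ> g) has_derivative (h' \<circ> (\<lambda>d. d *\<^sub>R axis i 1))) (at (\<zeta> $ i) within {0..})"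
    by (rule diff_chain_within)
  moreover have "h \<circ> g = along i \<zeta> h" by (simp add: fun_eq_iff along_def g_def)
  moreover have "h' \<circ> (\<lambda>d. d *\<^sub>R axis i 1) = (\<lambda>d. d *\<^sub>R h' (axis i 1))"
    using linear_simps(5)[OF has_derivative_bounded_linear[OF h]] by (simp add: fun_eq_iff)
  ultimately have "(along i \<zeta> h has_vector_derivative h' (axis i 1)) (at (\<zeta> $ i) within {0..})"
    by (simp add: has_vector_derivative_def)
  then show ?thesis
    unfolding partial_deriv_def
    by (rule vector_derivative_within[OF at_within_Ici_neq_bot, rotated])
      (use \<zeta> in \<open>simp add: orthant_def\<close>)
qed

context boundary_walk
begin

definition flow :: "real ^ 'v \<Rightarrow> real \<Rightarrow> real ^ 'v" where
  "flow \<zeta> t = equilibrium + P t (\<zeta> - equilibrium)"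

lemma flow_eq: "0 \<le> t \<Longrightarrow> flow \<zeta> t = P t \<zeta> + immigrants t"
  by (simp add: flow_def immigrants_def P_diff)

lemma flow_orthant: "\<zeta> \<in> orthant \<Longrightarrow> 0 \<le> t \<Longrightarrow> flow \<zeta> t \<in> orthant"
  using P_orthant[of \<zeta> t] immigrants_orthant[of t] by (simp add: flow_eq orthant_def)

lemma det_gen_has_derivative:
  assumes h: "(h has_derivative h') (at \<zeta> within orthant)" and "\<zeta> \<in> orthant"
  shows "det_gen p c \<alpha> \<gamma> h \<zeta> = h' (drift \<zeta> + source)"
proof -
  have "h' (drift \<zeta> + source) = h' (\<Sum>i\<in>UNIV. (drift \<zeta> + source) $ i *\<^sub>R axis i 1)"
    using basis_expansion[of "drift \<zeta> + source"] by (simp add: scalar_mult_eq_scaleR)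
  also have "\<dots> = (\<Sum>i\<in>UNIV. (drift \<zeta> + source) $ i * h' (axis i 1))"
    using has_derivative_linear[OF h] by (simp add: linear_sum linear_cmul)
  finally show ?thesis
    by (simp add: det_gen_eq partial_deriv_eq[OF assms])
qed

lemma flow_is_deterministic_flow: "deterministic_flow_of (det_gen p c \<alpha> \<gamma>) flow"
  unfolding deterministic_flow_of_def
proof (intro ballI conjI allI impI)
  fix \<zeta> :: "real ^ 'v" and h :: "real ^ 'v \<Rightarrow> real" and t :: real
  assume \<zeta>: "\<zeta> \<in> orthant" and h: "h differentiable_on orthant" and t: "0 \<le> t"
  obtain h' where h': "(h has_derivative h') (at (flow \<zeta> t) within orthant)"
    using h flow_orthant[OF \<zeta> t] by (auto simp: differentiable_on_def differentiable_def)
  have "(flow \<zeta> has_vector_derivative drift (P t (\<zeta> - equilibrium))) (at t within {0..})"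
    unfolding flow_def by (auto intro!: derivative_eq_intros)
  moreover have "drift (P t (\<zeta> - equilibrium)) = drift (flow \<zeta> t) + source"
    by (simp add: flow_def drift_linear drift_equilibrium)
  ultimately have "(flow \<zeta> has_derivative (\<lambda>d. d *\<^sub>R (drift (flow \<zeta> t) + source))) (at t within {0..})"
    by (simp add: has_vector_derivative_def)
  moreover have "(h has_derivative h') (at (flow \<zeta> t) within flow \<zeta> ` {0..})"
    by (rule has_derivative_subset[OF h']) (use flow_orthant[OF \<zeta>] in auto)
  ultimately have "((h \<circ> flow \<zeta>) has_derivative (h' \<circ> (\<lambda>d. d *\<^sub>R (drift (flow \<zeta> t) + source)))) (at t within {0..})"
    by (rule diff_chain_within)
  then show "((\<lambda>s. h (flow \<zeta> s)) has_real_derivative det_gen p c \<alpha> \<gamma> h (flow \<zeta> t)) (at t within {0..})"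
    using linear_cmul[OF has_derivative_linear[OF h']]
    by (simp add: has_field_derivative_def o_def mult_commute_abs
        det_gen_has_derivative[OF h' flow_orthant[OF \<zeta> t]])
qed (use flow_orthant in \<open>auto simp: flow_def\<close>)

text \<open>Testing the generator on the coordinate functions recovers the differential equation;
  subtracting \<open>equilibrium\<close> makes it the linear equation solved by
  \<open>P\<close>.\<close>

lemma deterministic_flow_unique:
  assumes Z: "deterministic_flow_of (det_gen p c \<alpha> \<gamma>) Z" and \<zeta>: "\<zeta> \<in> orthant" and "0 \<le> t"
  shows "Z \<zeta> t = flow \<zeta> t"
proof -
  have Z0: "Z \<zeta> 0 = \<zeta>" and Zo: "\<And>t. 0 \<le> t \<Longrightarrow> Z \<zeta> t \<in> orthant"
    using Z \<zeta> by (auto simp: deterministic_flow_of_def)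
  have "(Z \<zeta> has_vector_derivative drift (Z \<zeta> t) + source) (at t within {0..})" if t: "0 \<le> t" for t
  proof -
    have "((\<lambda>s. Z \<zeta> s $ k) has_real_derivative (drift (Z \<zeta> t) + source) $ k) (at t within {0..})" for k
    proof -
      have d: "((\<lambda>x. x $ k) has_derivative (\<lambda>x. x $ k)) (at \<xi> within orthant)" for \<xi> :: "real ^ 'v"
        by (intro bounded_linear_imp_has_derivative bounded_linear_vec_nth)
      then have "(\<lambda>x::real^'v. x $ k) differentiable_on orthant"
        by (auto simp: differentiable_on_def differentiable_def)
      then have "((\<lambda>s. Z \<zeta> s $ k) has_real_derivative det_gen p c \<alpha> \<gamma> (\<lambda>x. x $ k) (Z \<zeta> t)) (at t within {0..})"
        using Z \<zeta> t by (auto simp: deterministic_flow_of_def)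
      then show ?thesis
        by (simp only: det_gen_has_derivative[OF d Zo[OF t]])
    qed
    then show ?thesis
      unfolding has_vector_derivative_def has_derivative_componentwise_within[of "Z \<zeta>"]
      by (auto simp: Basis_vec_def inner_axis has_field_derivative_def mult_commute_abs)
  qed
  then have "((\<lambda>t. Z \<zeta> t - equilibrium) has_vector_derivative drift (Z \<zeta> t - equilibrium)) (at t within {0..})"
    if "0 \<le> t" for t
    using that by (auto simp: drift_linear drift_equilibrium intro!: derivative_eq_intros)
  from drift_solution_eq_P[OF this \<open>0 \<le> t\<close>] show ?thesis
    by (simp add: flow_def Z0 algebra_simps)
qed

lemma fixed_point_iff:
  assumes Z: "deterministic_flow_of (det_gen p c \<alpha> \<gamma>) Z"
  shows "fixed_point Z \<zeta> \<longleftrightarrow> \<zeta> = equilibrium"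
proof
  assume fp: "fixed_point Z \<zeta>"
  then have "\<forall>\<^sub>F t in at_top. P t (\<zeta> - equilibrium) = \<zeta> - equilibrium"
    using deterministic_flow_unique[OF Z, of \<zeta>]
    by (intro eventually_mono[OF eventually_ge_at_top[of 0]])
      (auto simp: fixed_point_def flow_def algebra_simps)
  with P_tendsto_0[of "\<zeta> - equilibrium"] have "((\<lambda>t::real. \<zeta> - equilibrium) \<longlongrightarrow> 0) at_top"
    using tendsto_cong by fastforce
  then show "\<zeta> = equilibrium" by (simp add: tendsto_const_iff)
next
  assume "\<zeta> = equilibrium"
  moreover have "P t 0 = 0" if "0 \<le> t" for t using P_scaleR[OF that, of 0 0] by simp
  ultimately show "fixed_point Z \<zeta>"
    using equilibrium_orthant deterministic_flow_unique[OF Z equilibrium_orthant]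
    by (simp add: fixed_point_def flow_def)
qed

end

subsection \<open>Power series and Poisson products\<close>

lemma integrable_pmf_iff_abs_summable:
  fixes f :: "'a \<Rightarrow> real"
  shows "integrable (measure_pmf q) f \<longleftrightarrow> Infinite_Set_Sum.abs_summable_on (\<lambda>x. pmf q x * f x) UNIV"
  unfolding abs_summable_on_def measure_pmf_eq_density by (subst integrable_density) simp_all

lemma pmf_reweight:
  fixes f :: "'a \<Rightarrow> real"
  assumes "\<And>x. pmf q x = pmf p x * w x"
  shows "integrable (measure_pmf q) f \<longleftrightarrow> integrable (measure_pmf p) (\<lambda>x. w x * f x)"
    and "measure_pmf.expectation q f = measure_pmf.expectation p (\<lambda>x. w x * f x)"
  by (simp_all add: integrable_pmf_iff_abs_summable pmf_expectation_eq_infsetsum assms mult.assoc)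

lemma integrable_pmf_bounded:
  fixes f :: "'a \<Rightarrow> real"
  assumes "\<And>x. \<bar>f x\<bar> \<le> C"
  shows "integrable (measure_pmf p) f"
  by (rule measure_pmf.integrable_const_bound[where B = C]) (use assms in auto)

lemma integrable_pmf_mult_bounded:
  fixes f g :: "'a \<Rightarrow> real"
  assumes "integrable (measure_pmf p) f" "\<And>x. \<bar>g x\<bar> \<le> C"
  shows "integrable (measure_pmf p) (\<lambda>x. f x * g x)"
proof (rule Bochner_Integration.integrable_bound)
  show "integrable (measure_pmf p) (\<lambda>x. C * f x)" using assms(1) by simp
  have "\<bar>f x * g x\<bar> \<le> \<bar>C * f x\<bar>" for x
    using mult_left_mono[OF order_trans[OF assms(2)[of x] abs_ge_self], of "\<bar>f x\<bar>"]
    by (simp add: abs_mult mult.commute)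
  then show "AE x in measure_pmf p. norm (f x * g x) \<le> norm (C * f x)" by simp
qed simp

text \<open>Group the points by the value of \<open>X\<close>: the n-th partial sum is the integrand
  cut off at \<open>X x < n\<close>, so dominated convergence with majorant |f| applies, up to and
  including |s| = 1.\<close>

lemma expectation_power_sums:
  fixes f :: "'a \<Rightarrow> real"
  assumes f: "integrable (measure_pmf p) f" and s: "\<bar>s\<bar> \<le> 1"
  shows "(\<lambda>k. measure_pmf.expectation p (\<lambda>x. f x * of_bool (X x = k)) * s ^ k) sums
    measure_pmf.expectation p (\<lambda>x. f x * s ^ X x)"
proof -
  define g where "g n x = (\<Sum>k<n. f x * of_bool (X x = k) * s ^ k)" for n x
  have g: "g n x = (if X x < n then f x * s ^ X x else 0)" for n x
  proof -
    have "g n x = (\<Sum>k<n. if X x = k then f x * s ^ X x else 0)"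
      unfolding g_def by (rule sum.cong) auto
    then show ?thesis by simp
  qed
  have spow: "\<bar>s ^ k\<bar> \<le> 1" for k using s by (simp add: power_abs power_le_one)
  have "(\<lambda>n. measure_pmf.expectation p (g n)) \<longlonglongrightarrow> measure_pmf.expectation p (\<lambda>x. f x * s ^ X x)"
  proof (rule integral_dominated_convergence)
    show "integrable (measure_pmf p) (\<lambda>x. \<bar>f x\<bar>)" using f by simp
    have "\<forall>\<^sub>F n in sequentially. g n x = f x * s ^ X x" for x
      using eventually_gt_at_top[of "X x"] by eventually_elim (simp add: g)
    then show "AE x in measure_pmf p. (\<lambda>n. g n x) \<longlonglongrightarrow> f x * s ^ X x"
      by (auto intro: tendsto_eventually)
    show "AE x in measure_pmf p. norm (g n x) \<le> \<bar>f x\<bar>" for n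
      using mult_left_mono[OF spow, of "\<bar>f x\<bar>" for x] by (auto simp: g abs_mult)
  qed auto
  moreover have "measure_pmf.expectation p (g n) =
      (\<Sum>k<n. measure_pmf.expectation p (\<lambda>x. f x * of_bool (X x = k)) * s ^ k)" for n
    unfolding g_def
    by (subst Bochner_Integration.integral_sum)
      (auto intro!: integrable_mult_left integrable_pmf_mult_bounded[OF f, of _ 1])
  ultimately show ?thesis by (simp add: sums_def)
qed

lemma bounded_nat_times_power:
  fixes r :: real
  assumes "0 < r" "r < 1"
  shows "\<exists>C. \<forall>k. \<bar>real k * r ^ (k - 1)\<bar> \<le> C"
proof -
  have "(\<lambda>n. real n * r ^ n) \<longlonglongrightarrow> 0"
    using assms by (intro powser_times_n_limit_0) simp
  then have "Bseq (\<lambda>n. real n * r ^ n)" by (intro convergent_imp_Bseq convergentI)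
  then obtain C where C: "\<bar>real n * r ^ n\<bar> \<le> C" for n by (auto simp: Bseq_def)
  have "\<bar>real k * r ^ (k - 1)\<bar> \<le> C / r" for k
    using C[of k] C[of 0] \<open>0 < r\<close> by (cases k) (auto simp: field_simps abs_mult)
  then show ?thesis by blast
qed

text \<open>For r strictly between |s| and 1 the numbers k * r^(k-1) are bounded, so f * X * r^(X-1)
  is integrable. Its generating function at s / r, by the previous expansion, is the termwise
  derivative of the series.\<close>

lemma expectation_power_deriv:
  fixes f :: "'a \<Rightarrow> real"
  assumes f: "integrable (measure_pmf p) f" and s: "\<bar>s\<bar> < 1"
  shows "integrable (measure_pmf p) (\<lambda>x. real (X x) * (f x * s ^ (X x - 1)))" (is ?int)
    and "((\<lambda>s. measure_pmf.expectation p (\<lambda>x. f x * s ^ X x)) has_real_derivative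
      measure_pmf.expectation p (\<lambda>x. real (X x) * (f x * s ^ (X x - 1)))) (at s)" (is ?der)
proof -
  obtain r where r: "\<bar>s\<bar> < r" "r < 1" using s dense by blast
  then have "0 < r" by linarith
  define a where "a k = measure_pmf.expectation p (\<lambda>x. f x * of_bool (X x = k))" for k
  define f' where "f' x = f x * (real (X x) * r ^ (X x - 1))" for x
  obtain C where C: "\<bar>real k * r ^ (k - 1)\<bar> \<le> C" for k
    using bounded_nat_times_power[OF \<open>0 < r\<close> \<open>r < 1\<close>] by blast
  have f': "integrable (measure_pmf p) f'"
    unfolding f'_def by (rule integrable_pmf_mult_bounded[OF f C])
  have f's: "f' x * (s / r) ^ (X x - 1) = real (X x) * (f x * s ^ (X x - 1))" for x
    using \<open>0 < r\<close> by (simp add: f'_def power_divide)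
  have sr: "\<bar>s / r\<bar> \<le> 1" using r \<open>0 < r\<close> by simp
  then have "\<bar>(s / r) ^ k\<bar> \<le> 1" for k by (simp add: power_abs power_le_one del: abs_divide)
  from integrable_pmf_mult_bounded[OF f' this, of "\<lambda>x. X x - 1"] show ?int
    by (simp only: f's)
  have "measure_pmf.expectation p (\<lambda>x. f' x * of_bool (X x - 1 = k)) * (s / r) ^ k = diffs a k * s ^ k" for k
  proof -
    have "f' x * of_bool (X x - 1 = k) = (real (Suc k) * r ^ k) * (f x * of_bool (X x = Suc k))" for x
      by (cases "X x") (auto simp: f'_def)
    then have "measure_pmf.expectation p (\<lambda>x. f' x * of_bool (X x - 1 = k)) = real (Suc k) * r ^ k * a (Suc k)"
      unfolding a_def by simp
    then show ?thesis
      using \<open>0 < r\<close> by (simp add: diffs_def power_divide)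
  qed
  then have "(\<lambda>k. diffs a k * s ^ k) sums measure_pmf.expectation p (\<lambda>x. real (X x) * (f x * s ^ (X x - 1)))"
    using expectation_power_sums[OF f' sr, of "\<lambda>x. X x - 1"] by (simp only: f's)
  moreover have "((\<lambda>s. \<Sum>k. a k * s ^ k) has_real_derivative (\<Sum>k. diffs a k * s ^ k)) (at s)"
    using s by (intro termdiffs_strong'[of 1])
      (auto simp: a_def intro: sums_summable[OF expectation_power_sums[OF f]])
  ultimately have "((\<lambda>s. \<Sum>k. a k * s ^ k) has_real_derivative
      measure_pmf.expectation p (\<lambda>x. real (X x) * (f x * s ^ (X x - 1)))) (at s)"
    by (simp add: sums_iff)
  then show ?der
  proof (rule has_field_derivative_transform_within_open)
    show "open {-1<..<1::real}" "s \<in> {-1<..<1}" using s by auto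
    show "(\<Sum>k. a k * x ^ k) = measure_pmf.expectation p (\<lambda>y. f y * x ^ X y)" if "x \<in> {-1<..<1}" for x
      using expectation_power_sums[OF f, of x X] that by (simp add: a_def sums_iff abs_le_iff)
  qed
qed

text \<open>Otherwise the difference would have an isolated zero at the origin, although it vanishes
  on [0, 1). Agreement on this side is what generating functions provide, their arguments 1 - g
  lying in [0, 1].\<close>

lemma powser_coeffs_unique:
  fixes a b :: "nat \<Rightarrow> real"
  assumes "\<And>s. \<bar>s\<bar> < 1 \<Longrightarrow> summable (\<lambda>k. a k * s ^ k)" "\<And>s. \<bar>s\<bar> < 1 \<Longrightarrow> summable (\<lambda>k. b k * s ^ k)"
    and eq: "\<And>s. 0 \<le> s \<Longrightarrow> s < 1 \<Longrightarrow> (\<Sum>k. a k * s ^ k) = (\<Sum>k. b k * s ^ k)"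
  shows "a k = b k"
proof (rule ccontr)
  assume neq: "a k \<noteq> b k"
  define f where "f s = (\<Sum>k. a k * s ^ k) - (\<Sum>k. b k * s ^ k)" for s
  have f: "(\<lambda>k. (a k - b k) * (s - 0) ^ k) sums f s" if "norm (s - 0) < 1" for s
    using sums_diff[OF summable_sums[OF assms(1)] summable_sums[OF assms(2)], of s s] that
    by (simp add: f_def algebra_simps)
  have f0: "f 0 = 0" using eq[of 0] by (simp add: f_def)
  then have "k > 0" using neq by (cases k) (auto simp: f_def)
  moreover have "a k - b k \<noteq> 0" using neq by simp
  ultimately obtain e where "0 < e" and e: "\<And>z. z \<in> cball 0 e - {0} \<Longrightarrow> f z \<noteq> 0"
    using powser_0_nonzero[OF zero_less_one f f0] by blast
  then have "f (min e (1/2)) \<noteq> 0" by (intro e) auto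
  then show False using eq[of "min e (1/2)"] \<open>0 < e\<close> by (simp add: f_def)
qed

section \<open>Poisson weights, the Mecke identity and the intertwining\<close>

lemma pmf_poisson_nonneg:
  assumes "0 \<le> z"
  shows "pmf (poisson z) n = z ^ n / fact n * exp (- z)"
  \<comment> \<open>With 0 ^ 0 = 1 the formula also covers the point mass at parameter 0.\<close>
  using assms by (cases "z = 0") (auto simp: poisson_def power_0_left indicator_def)

lemma pmf_poisson_product:
  assumes "\<zeta> \<in> orthant"
  shows "pmf (poisson_product \<zeta>) \<eta> = (\<Prod>i\<in>UNIV. \<zeta> $ i ^ \<eta> i / fact (\<eta> i) * exp (- \<zeta> $ i))"
  using assms by (simp add: poisson_product_def pmf_Pi orthant_def pmf_poisson_nonneg)

text \<open>For the Poisson weights, n times the weight of n is z times the weight of n - 1. Adding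
  a particle at i is a bijection onto the configurations with \<eta> i > 0, and the others
  contribute nothing because of the factor \<open>real (\<eta> i)\<close>.\<close>

lemma mecke:
  fixes h :: "('v::finite \<Rightarrow> nat) \<Rightarrow> real"
  assumes \<zeta>: "\<zeta> \<in> orthant"
  shows "integrable (poisson_product \<zeta>) (\<lambda>\<eta>. real (\<eta> i) * h \<eta>) \<longleftrightarrow>
      integrable (poisson_product \<zeta>) (\<lambda>\<eta>. \<zeta> $ i * h (\<eta>(i := \<eta> i + 1)))" (is ?int)
    and "measure_pmf.expectation (poisson_product \<zeta>) (\<lambda>\<eta>. real (\<eta> i) * h \<eta>) =
      measure_pmf.expectation (poisson_product \<zeta>) (\<lambda>\<eta>. \<zeta> $ i * h (\<eta>(i := \<eta> i + 1)))" (is ?exp)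
proof -
  have alg: "(a * e * q) * n = (b * e * q) * z" if "a * n = b * z" for a b e q n z :: real
  proof -
    have "(a * e * q) * n = (a * n) * (e * q)" by (simp add: mult_ac)
    then show ?thesis unfolding that by (simp add: mult_ac)
  qed
  define u where "u \<eta> = \<eta>(i := \<eta> i + 1)" for \<eta> :: "'v \<Rightarrow> nat"
  define F where "F \<eta> = pmf (poisson_product \<zeta>) \<eta> * (real (\<eta> i) * h \<eta>)" for \<eta>
  have "bij_betw u UNIV {\<eta>. \<eta> i > 0}"
    by (rule bij_betwI[where g = "\<lambda>\<eta>. \<eta>(i := \<eta> i - 1)"]) (auto simp: u_def)
  note bij = abs_summable_on_reindex_bij_betw[OF this, of F] infsetsum_reindex_bij_betw[OF this, of F]
  have step: "F (u \<eta>) = pmf (poisson_product \<zeta>) \<eta> * (\<zeta> $ i * h (u \<eta>))" for \<eta>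
  proof -
    have "(\<Prod>k\<in>UNIV. \<zeta> $ k ^ u \<eta> k / fact (u \<eta> k) * exp (- \<zeta> $ k)) * real (u \<eta> i) =
        (\<Prod>k\<in>UNIV. \<zeta> $ k ^ \<eta> k / fact (\<eta> k) * exp (- \<zeta> $ k)) * \<zeta> $ i"
    proof -
      have "(\<Prod>k\<in>UNIV - {i}. \<zeta> $ k ^ u \<eta> k / fact (u \<eta> k) * exp (- \<zeta> $ k)) =
          (\<Prod>k\<in>UNIV - {i}. \<zeta> $ k ^ \<eta> k / fact (\<eta> k) * exp (- \<zeta> $ k))"
        by (rule prod.cong) (auto simp: u_def)
      moreover have "\<zeta> $ i ^ u \<eta> i / fact (u \<eta> i) * real (u \<eta> i) = \<zeta> $ i ^ \<eta> i / fact (\<eta> i) * \<zeta> $ i"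
        by (simp add: u_def divide_simps del: of_nat_Suc)
      then have "(\<zeta> $ i ^ u \<eta> i / fact (u \<eta> i) * e * q) * real (u \<eta> i) =
          (\<zeta> $ i ^ \<eta> i / fact (\<eta> i) * e * q) * \<zeta> $ i" for e q
        by (rule alg)
      ultimately show ?thesis
        by (simp only: prod.remove[OF finite UNIV_I, of _ i])
    qed
    then show ?thesis
      by (simp add: F_def pmf_poisson_product[OF \<zeta>] mult.assoc[symmetric])
  qed
  have "Infinite_Set_Sum.abs_summable_on F UNIV \<longleftrightarrow>
      Infinite_Set_Sum.abs_summable_on F {\<eta>. \<eta> i > 0}"
    by (rule abs_summable_on_cong_neutral) (auto simp: F_def)
  then show ?int
    by (simp only: integrable_pmf_iff_abs_summable F_def[symmetric] u_def[symmetric] step[symmetric] bij)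
  have "infsetsum F UNIV = infsetsum F {\<eta>. \<eta> i > 0}"
    by (rule infsetsum_cong_neutral) (auto simp: F_def)
  then show ?exp
    by (simp only: pmf_expectation_eq_infsetsum F_def[symmetric] u_def[symmetric] step[symmetric] bij)
qed

text \<open>A density of one Poisson law with respect to another. The reference parameter R has to
  be positive, while x = 0 is covered by 0 ^ 0 = 1.\<close>

lemma pmf_poisson_product_rescale:
  assumes "\<zeta> \<in> orthant" "0 < R" "0 \<le> x"
  shows "pmf (poisson_product (\<chi> k. if k = i then x else \<zeta> $ k)) \<eta> =
    pmf (poisson_product (\<chi> k. if k = i then R else \<zeta> $ k)) \<eta> * (exp (R - x) * (x / R) ^ \<eta> i)"
proof -
  have o: "(\<chi> k. if k = i then y else \<zeta> $ k) \<in> orthant" if "0 \<le> y" for y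
    using assms(1) that by (simp add: orthant_def)
  have R: "0 \<le> R" using assms by simp
  show ?thesis
    unfolding pmf_poisson_product[OF o[OF \<open>0 \<le> x\<close>]] pmf_poisson_product[OF o[OF R]]
    by (subst (1 2) prod.remove[of _ i])
      (use assms in \<open>auto simp: power_divide exp_diff exp_minus field_simps intro!: prod.cong\<close>)
qed

text \<open>
  Along the \<open>i\<close>-th coordinate, the Poisson products are reweightings of one with a slightly larger
  parameter \<open>R\<close>, so the intertwiner becomes a power series in \<open>x / R\<close>; the derivative is shifted
  back by the Mecke identity.
\<close>

lemma intertwiner_partial_derivative:
  fixes f :: "('v::finite \<Rightarrow> nat) \<Rightarrow> real"
  assumes \<zeta>: "\<zeta> \<in> orthant" and "0 < e"
    and f: "\<And>\<xi>. \<xi> \<in> orthant \<Longrightarrow> dist \<xi> \<zeta> < e \<Longrightarrow> integrable (poisson_product \<xi>) f"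
  shows "integrable (poisson_product \<zeta>) (\<lambda>\<eta>. f (\<eta>(i := \<eta> i + 1)))" (is ?int)
    and "partial_deriv i (intertwiner f) \<zeta> =
      intertwiner (\<lambda>\<eta>. f (\<eta>(i := \<eta> i + 1))) \<zeta> - intertwiner f \<zeta>" (is ?der)
proof -
  \<comment> \<open>Half the radius keeps the shifted parameter inside the ball where f is
    integrable, yet makes R > 0 and s < 1 even when \<zeta> lies on the boundary.\<close>
  define R where "R = \<zeta> $ i + e / 2"
  define \<rho> where "\<rho> x = (\<chi> k. if k = i then x else \<zeta> $ k)" for x
  define s where "s = \<zeta> $ i / R"
  let ?E = "\<lambda>g. measure_pmf.expectation (poisson_product (\<rho> R)) g"
  have \<zeta>i: "0 \<le> \<zeta> $ i" using \<zeta> by (simp add: orthant_def)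
  then have R: "0 < R" and s: "\<bar>s\<bar> < 1" using \<open>0 < e\<close> by (auto simp: R_def s_def field_simps)
  have \<rho>\<zeta>: "\<rho> (\<zeta> $ i) = \<zeta>" by (simp add: \<rho>_def vec_eq_iff)
  have \<rho>R: "\<rho> R \<in> orthant" using \<zeta> R by (auto simp: orthant_def \<rho>_def)
  have "\<rho> R - \<zeta> = (e / 2) *\<^sub>R axis i 1" by (simp add: vec_eq_iff \<rho>_def R_def axis_def)
  then have "dist (\<rho> R) \<zeta> < e" using \<open>0 < e\<close> by (simp add: dist_norm)
  then have fR: "integrable (poisson_product (\<rho> R)) f" by (rule f[OF \<rho>R])
  note reweight = pmf_reweight[OF pmf_poisson_product_rescale[OF \<zeta> R, where i = i, folded \<rho>_def]]
  note deriv = expectation_power_deriv[OF fR s, of "\<lambda>\<eta>. \<eta> i"]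
  have "integrable (poisson_product (\<rho> R)) (\<lambda>\<eta>. R * (f (\<eta>(i := \<eta> i + 1)) * s ^ \<eta> i))"
    using deriv(1) by (subst (asm) mecke[OF \<rho>R]) (simp add: \<rho>_def)
  then have "integrable (poisson_product (\<rho> R)) (\<lambda>\<eta>. f (\<eta>(i := \<eta> i + 1)) * s ^ \<eta> i)"
    using R by simp
  then have "integrable (poisson_product (\<rho> R)) (\<lambda>\<eta>. exp (R - \<zeta> $ i) * (f (\<eta>(i := \<eta> i + 1)) * s ^ \<eta> i))"
    by (rule integrable_mult_right)
  then have "integrable (poisson_product (\<rho> R)) (\<lambda>\<eta>. (exp (R - \<zeta> $ i) * s ^ \<eta> i) * f (\<eta>(i := \<eta> i + 1)))"
    by (simp add: mult_ac)
  then show ?int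
    using reweight(1)[OF \<zeta>i] by (simp add: \<rho>\<zeta> s_def)
  have shift: "?E (\<lambda>\<eta>. real (\<eta> i) * (f \<eta> * s ^ (\<eta> i - 1))) =
      R * exp (\<zeta> $ i - R) * intertwiner (\<lambda>\<eta>. f (\<eta>(i := \<eta> i + 1))) \<zeta>"
  proof -
    have "?E (\<lambda>\<eta>. real (\<eta> i) * (f \<eta> * s ^ (\<eta> i - 1))) = R * ?E (\<lambda>\<eta>. f (\<eta>(i := \<eta> i + 1)) * s ^ \<eta> i)"
      by (subst mecke[OF \<rho>R]) (simp add: \<rho>_def)
    moreover have "intertwiner (\<lambda>\<eta>. f (\<eta>(i := \<eta> i + 1))) \<zeta> =
        exp (R - \<zeta> $ i) * ?E (\<lambda>\<eta>. f (\<eta>(i := \<eta> i + 1)) * s ^ \<eta> i)"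
      using reweight(2)[OF \<zeta>i, of "\<lambda>\<eta>. f (\<eta>(i := \<eta> i + 1))"]
      by (simp add: \<rho>\<zeta> s_def intertwiner_def mult_ac)
    ultimately show ?thesis by (simp add: exp_diff)
  qed
  have along: "along i \<zeta> (intertwiner f) x = exp (R - x) * ?E (\<lambda>\<eta>. f \<eta> * (x / R) ^ \<eta> i)" if "0 \<le> x" for x
  proof -
    have "along i \<zeta> (intertwiner f) x = ?E (\<lambda>\<eta>. exp (R - x) * (x / R) ^ \<eta> i * f \<eta>)"
      using reweight(2)[OF that, of f] by (simp only: along_def intertwiner_def flip: \<rho>_def)
    also have "\<dots> = ?E (\<lambda>\<eta>. exp (R - x) * (f \<eta> * (x / R) ^ \<eta> i))"
      by (simp only: mult_ac)
    finally show ?thesis by simp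
  qed
  have chain: "((\<lambda>x. ?E (\<lambda>\<eta>. f \<eta> * (x / R) ^ \<eta> i)) has_real_derivative
      ?E (\<lambda>\<eta>. real (\<eta> i) * (f \<eta> * s ^ (\<eta> i - 1))) * (1 / R)) (at (\<zeta> $ i))"
  proof -
    have "((\<lambda>x. x / R) has_real_derivative 1 / R) (at (\<zeta> $ i))"
      using R by (auto intro!: derivative_eq_intros)
    then show ?thesis
      unfolding s_def
      by (rule DERIV_chain2[where g = "\<lambda>x. x / R" and x = "\<zeta> $ i", OF deriv(2)[unfolded s_def]])
  qed
  have "((\<lambda>x. exp (R - x)) has_real_derivative - exp (R - \<zeta> $ i)) (at (\<zeta> $ i))"
    by (auto intro!: derivative_eq_intros)
  note product = DERIV_mult[OF this chain]
  have "intertwiner f \<zeta> = exp (R - \<zeta> $ i) * ?E (\<lambda>\<eta>. f \<eta> * s ^ \<eta> i)"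
    using along[OF \<zeta>i] by (simp add: along_def s_def \<rho>\<zeta>[unfolded \<rho>_def])
  \<comment> \<open>In the product rule the exponential contributes minus
    \<open>intertwiner f \<zeta>\<close>; in the series term the factor R from the Mecke identity
    cancels the 1 / R of the inner derivative.\<close>
  then have "- exp (R - \<zeta> $ i) * ?E (\<lambda>\<eta>. f \<eta> * (\<zeta> $ i / R) ^ \<eta> i) +
      ?E (\<lambda>\<eta>. real (\<eta> i) * (f \<eta> * s ^ (\<eta> i - 1))) * (1 / R) * exp (R - \<zeta> $ i) =
      intertwiner (\<lambda>\<eta>. f (\<eta>(i := \<eta> i + 1))) \<zeta> - intertwiner f \<zeta>"
    using R unfolding shift s_def[symmetric] by (simp add: exp_diff)
  from DERIV_cong[OF product this]
  have "((\<lambda>x. exp (R - x) * ?E (\<lambda>\<eta>. f \<eta> * (x / R) ^ \<eta> i)) has_real_derivative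
      intertwiner (\<lambda>\<eta>. f (\<eta>(i := \<eta> i + 1))) \<zeta> - intertwiner f \<zeta>) (at (\<zeta> $ i))" .
  \<comment> \<open>The formula is differentiable from both sides, but represents
    \<open>along\<close> only for x \<ge> 0, so the derivative is restricted before it is
    transferred.\<close>
  then have "((\<lambda>x. exp (R - x) * ?E (\<lambda>\<eta>. f \<eta> * (x / R) ^ \<eta> i)) has_real_derivative
      intertwiner (\<lambda>\<eta>. f (\<eta>(i := \<eta> i + 1))) \<zeta> - intertwiner f \<zeta>) (at (\<zeta> $ i) within {0..})"
    by (rule has_field_derivative_at_within)
  then have "(along i \<zeta> (intertwiner f) has_real_derivative
      intertwiner (\<lambda>\<eta>. f (\<eta>(i := \<eta> i + 1))) \<zeta> - intertwiner f \<zeta>) (at (\<zeta> $ i) within {0..})"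
    by (rule has_field_derivative_transform_within[where d = 1]) (use \<zeta>i along in auto)
  then show ?der
    unfolding partial_deriv_def has_real_derivative_iff_has_vector_derivative
    by (rule vector_derivative_within[OF at_within_Ici_neq_bot[OF \<zeta>i]])
qed

lemma mecke_has_integral:
  fixes h :: "('v::finite \<Rightarrow> nat) \<Rightarrow> real"
  assumes "\<zeta> \<in> orthant" "has_bochner_integral (poisson_product \<zeta>) (\<lambda>\<eta>. h (\<eta>(i := \<eta> i + 1))) x"
  shows "has_bochner_integral (poisson_product \<zeta>) (\<lambda>\<eta>. real (\<eta> i) * h \<eta>) (\<zeta> $ i * x)"
  using assms by (simp add: has_bochner_integral_iff mecke)

text \<open>Under the Mecke identity the weight \<open>real (\<eta> k)\<close> restores the particle
  taken from k. Thus a jump from k to l contributes \<zeta> k * U l, and its loss term \<zeta> k * U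
  k.\<close>

lemma walk_edge_has_integral:
  fixes f :: "('v::finite \<Rightarrow> nat) \<Rightarrow> real"
  assumes \<zeta>: "\<zeta> \<in> orthant" and "i \<noteq> j"
    and up: "\<And>k. has_bochner_integral (poisson_product \<zeta>) (\<lambda>\<eta>. f (\<eta>(k := \<eta> k + 1))) (U k)"
  shows "has_bochner_integral (poisson_product \<zeta>) (walk_edge i j f) (- (\<zeta> $ i - \<zeta> $ j) * (U i - U j))"
proof -
  note stay = mecke_has_integral[where h = f, OF \<zeta> up]
  have jump: "has_bochner_integral (poisson_product \<zeta>)
      (\<lambda>\<eta>. real (\<eta> k) * f (\<eta>(k := \<eta> k - 1, l := \<eta> l + 1))) (\<zeta> $ k * U l)" if "k \<noteq> l" for k l
    by (rule mecke_has_integral[OF \<zeta>]) (use that up[of l] in simp)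
  have "walk_edge i j f =
      (\<lambda>\<eta>. (real (\<eta> i) * f (\<eta>(i := \<eta> i - 1, j := \<eta> j + 1)) - real (\<eta> i) * f \<eta>) +
        (real (\<eta> j) * f (\<eta>(j := \<eta> j - 1, i := \<eta> i + 1)) - real (\<eta> j) * f \<eta>))"
    using \<open>i \<noteq> j\<close>
    by (simp add: fun_eq_iff walk_edge_def right_diff_distrib fun_upd_twist[OF \<open>i \<noteq> j\<close>[symmetric]])
  moreover have "- (\<zeta> $ i - \<zeta> $ j) * (U i - U j) =
      (\<zeta> $ i * U j - \<zeta> $ i * U i) + (\<zeta> $ j * U i - \<zeta> $ j * U j)"
    by (simp add: algebra_simps)
  ultimately show ?thesis
    using has_bochner_integral_add[OF
        has_bochner_integral_diff[OF jump[OF \<open>i \<noteq> j\<close>] stay[of i]]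
        has_bochner_integral_diff[OF jump[OF \<open>i \<noteq> j\<close>[symmetric]] stay[of j]]]
    by (simp only:)
qed

text \<open>Here the restored particle cancels the removed one, so the gain term of absorption
  contributes \<zeta> i * V.\<close>

lemma walk_site_has_integral:
  fixes f :: "('v::finite \<Rightarrow> nat) \<Rightarrow> real"
  assumes \<zeta>: "\<zeta> \<in> orthant" and f: "has_bochner_integral (poisson_product \<zeta>) f V"
    and up: "has_bochner_integral (poisson_product \<zeta>) (\<lambda>\<eta>. f (\<eta>(i := \<eta> i + 1))) U"
  shows "has_bochner_integral (poisson_product \<zeta>) (walk_site a g i f) ((a - g * \<zeta> $ i) * (U - V))"
proof -
  note stay = mecke_has_integral[where h = f, OF \<zeta> up]
  have down: "has_bochner_integral (poisson_product \<zeta>)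
      (\<lambda>\<eta>. real (\<eta> i) * f (\<eta>(i := \<eta> i - 1))) (\<zeta> $ i * V)"
    by (rule mecke_has_integral[OF \<zeta>]) (use f in simp)
  have "walk_site a g i f = (\<lambda>\<eta>. a * (f (\<eta>(i := \<eta> i + 1)) - f \<eta>) +
      g * (real (\<eta> i) * f (\<eta>(i := \<eta> i - 1)) - real (\<eta> i) * f \<eta>))"
    by (simp add: fun_eq_iff walk_site_def algebra_simps)
  moreover have "(a - g * \<zeta> $ i) * (U - V) = a * (U - V) + g * (\<zeta> $ i * V - \<zeta> $ i * U)"
    by (simp add: algebra_simps)
  ultimately show ?thesis
    using has_bochner_integral_add[OF
        has_bochner_integral_mult_right[OF has_bochner_integral_diff[OF up f], of a]
        has_bochner_integral_mult_right[OF has_bochner_integral_diff[OF down stay], of g]]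
    by (simp only:)
qed

text \<open>Differentiating the intertwiner in direction i means adding a particle at i and
  subtracting the intertwiner itself. Hence U i - U j is the difference of the two partial
  derivatives, and the edge and site integrals have the form of the deterministic operators.\<close>

lemma poisson_intertwined_walk:
  fixes p :: "'v::finite \<Rightarrow> 'v \<Rightarrow> real"
  shows "poisson_intertwined (walk_gen p c \<alpha> \<gamma>) (det_gen p c \<alpha> \<gamma>)"
  unfolding poisson_intertwined_def
proof (intro allI ballI impI)
  fix f :: "('v \<Rightarrow> nat) \<Rightarrow> real" and \<zeta> :: "real ^ 'v"
  assume \<zeta>: "\<zeta> \<in> orthant" and "both_sides_defined (walk_gen p c \<alpha> \<gamma>) f \<zeta>"
  then obtain e where "0 < e"
    and e: "\<And>\<xi>. \<xi> \<in> orthant \<Longrightarrow> dist \<xi> \<zeta> < e \<Longrightarrow> integrable (poisson_product \<xi>) f"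
    by (auto simp: both_sides_defined_def)
  define U where "U i = intertwiner (\<lambda>\<eta>. f (\<eta>(i := \<eta> i + 1))) \<zeta>" for i
  note partial = intertwiner_partial_derivative[OF \<zeta> \<open>0 < e\<close> e]
  have f: "has_bochner_integral (poisson_product \<zeta>) f (intertwiner f \<zeta>)"
    using e[OF \<zeta>] \<open>0 < e\<close> by (simp add: has_bochner_integral_iff intertwiner_def)
  have up: "has_bochner_integral (poisson_product \<zeta>) (\<lambda>\<eta>. f (\<eta>(i := \<eta> i + 1))) (U i)" for i
    using partial(1)[of i] by (simp add: has_bochner_integral_iff intertwiner_def U_def)
  have U: "partial_deriv i (intertwiner f) \<zeta> = U i - intertwiner f \<zeta>" for i
    unfolding U_def by (rule partial(2))
  have "has_bochner_integral (poisson_product \<zeta>) (walk_gen p c \<alpha> \<gamma> f)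
      ((\<Sum>i\<in>UNIV. \<Sum>j\<in>UNIV - {i}. p i j * (- (\<zeta> $ i - \<zeta> $ j) * (U i - U j))) +
       (\<Sum>i\<in>UNIV. c i * ((\<alpha> i - \<gamma> i * \<zeta> $ i) * (U i - intertwiner f \<zeta>))))"
    unfolding walk_gen_def[abs_def]
    by (intro has_bochner_integral_add has_bochner_integral_sum has_bochner_integral_mult_right
        walk_edge_has_integral walk_site_has_integral \<zeta> f up) auto
  then show "intertwiner (walk_gen p c \<alpha> \<gamma> f) \<zeta> = det_gen p c \<alpha> \<gamma> (intertwiner f) \<zeta>"
    by (simp add: has_bochner_integral_iff intertwiner_def[of "walk_gen p c \<alpha> \<gamma> f"]
        det_gen_def det_edge_def det_site_def U)
qed

subsection \<open>Generating functions\<close>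

text \<open>The probability that no particle is marked when each one at i is marked independently
  with probability g i: the generating function monomial at 1 - g.\<close>

definition thinning :: "real ^ 'v \<Rightarrow> ('v::finite \<Rightarrow> nat) \<Rightarrow> real" where
  "thinning g \<eta> = (\<Prod>i\<in>UNIV. (1 - g $ i) ^ \<eta> i)"

lemma thinning_bounds:
  assumes "g \<in> {0..1}"
  shows "0 \<le> thinning g \<eta>" "thinning g \<eta> \<le> 1"
  using assms by (auto simp: thinning_def less_eq_vec_def intro!: prod_nonneg prod_le_1 power_le_one)

lemma expectation_poisson_power:
  assumes "0 \<le> z" "0 \<le> s" "s \<le> 1"
  shows "measure_pmf.expectation (poisson z) (\<lambda>n. s ^ n) = exp (- (z * (1 - s)))"
proof -
  have "(\<lambda>k. measure_pmf.expectation (poisson z) (\<lambda>n. 1 * of_bool (n = k)) * s ^ k) sums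
      measure_pmf.expectation (poisson z) (\<lambda>n. 1 * s ^ n)"
    by (rule expectation_power_sums) (use assms in auto)
  moreover have "measure_pmf.expectation (poisson z) (\<lambda>n. 1 * of_bool (n = k)) = pmf (poisson z) k" for k
  proof -
    have "(\<lambda>n. 1 * of_bool (n = k) :: real) = indicator {k}" by (auto simp: indicator_def)
    then show ?thesis by (simp add: pmf.rep_eq)
  qed
  moreover have "(\<lambda>k. pmf (poisson z) k * s ^ k) sums (exp (z * s) * exp (- z))"
    using sums_mult2[OF exp_converges[of "z * s"], of "exp (- z)"]
    by (simp add: pmf_poisson_nonneg assms power_mult_distrib divide_inverse mult_ac)
  ultimately have "measure_pmf.expectation (poisson z) (\<lambda>n. s ^ n) = exp (z * s) * exp (- z)"
    using sums_unique2 by fastforce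
  then show ?thesis by (simp add: algebra_simps flip: exp_add)
qed

lemma expectation_thinning_poisson_product:
  assumes "\<zeta> \<in> orthant" "g \<in> {0..1}"
  shows "measure_pmf.expectation (poisson_product \<zeta>) (thinning g) = exp (- (\<zeta> \<bullet> g))"
proof -
  have g: "0 \<le> g $ i" "g $ i \<le> 1" "0 \<le> \<zeta> $ i" for i
    using assms by (auto simp: less_eq_vec_def orthant_def)
  have "measure_pmf.expectation (poisson_product \<zeta>) (thinning g) =
      (\<Prod>i\<in>UNIV. measure_pmf.expectation (poisson (\<zeta> $ i)) (\<lambda>n. (1 - g $ i) ^ n))"
    unfolding poisson_product_def thinning_def
    by (rule expectation_prod_Pi_pmf)
      (auto intro!: integrable_pmf_bounded[of _ 1] simp: g power_le_one)
  also have "\<dots> = (\<Prod>i\<in>UNIV. exp (- (\<zeta> $ i * g $ i)))"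
    by (simp add: expectation_poisson_power g)
  also have "\<dots> = exp (- (\<zeta> \<bullet> g))"
    by (simp add: inner_vec_def exp_sum flip: sum_negf)
  finally show ?thesis .
qed

text \<open>The coordinates are treated one after another: A collects those whose generating
  variable has been replaced by a point indicator. To add a to A, the variable s a is left free and
  the coefficients of the two power series in it are compared; A = UNIV gives the point
  masses.\<close>

lemma pmf_eq_of_thinning:
  fixes \<mu> \<nu> :: "('v::finite \<Rightarrow> nat) pmf"
  assumes "\<And>g. g \<in> {0..1} \<Longrightarrow> measure_pmf.expectation \<mu> (thinning g) = measure_pmf.expectation \<nu> (thinning g)"
  shows "\<mu> = \<nu>"
proof -
  have key: "measure_pmf.expectation \<mu> (\<lambda>\<eta>. (\<Prod>i\<in>A. of_bool (\<eta> i = k i)) * (\<Prod>i\<in>- A. s i ^ \<eta> i)) =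
      measure_pmf.expectation \<nu> (\<lambda>\<eta>. (\<Prod>i\<in>A. of_bool (\<eta> i = k i)) * (\<Prod>i\<in>- A. s i ^ \<eta> i))"
    if "finite A" "\<And>i. 0 \<le> s i \<and> s i \<le> 1" for A k and s :: "'v \<Rightarrow> real"
    using that
  proof (induction A arbitrary: s rule: finite_induct)
    case empty
    then show ?case
      using assms[of "\<chi> i. 1 - s i"] by (simp add: thinning_def[abs_def] less_eq_vec_def)
  next
    case (insert a A)
    define f where "f \<eta> = (\<Prod>i\<in>A. of_bool (\<eta> i = k i)) * (\<Prod>i\<in>- insert a A. s i ^ \<eta> i)" for \<eta>
    have "\<bar>f \<eta>\<bar> \<le> 1" for \<eta>
      using insert.prems
      by (auto simp: f_def abs_mult abs_prod power_abs intro!: mult_le_one prod_le_1 prod_nonneg power_le_one)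
    then have int: "integrable (measure_pmf \<kappa>) f" for \<kappa> by (rule integrable_pmf_bounded)
    have split: "(\<Prod>i\<in>A. of_bool (\<eta> i = k i)) * (\<Prod>i\<in>- A. (s(a := t)) i ^ \<eta> i) = f \<eta> * t ^ \<eta> a" for \<eta> t
    proof -
      have "- A = insert a (- insert a A)" using insert.hyps by auto
      then have "(\<Prod>i\<in>- A. (s(a := t)) i ^ \<eta> i) = t ^ \<eta> a * (\<Prod>i\<in>- insert a A. (s(a := t)) i ^ \<eta> i)"
        by simp
      also have "(\<Prod>i\<in>- insert a A. (s(a := t)) i ^ \<eta> i) = (\<Prod>i\<in>- insert a A. s i ^ \<eta> i)"
        by (rule prod.cong) auto
      finally show ?thesis by (simp add: f_def)
    qed
    have "measure_pmf.expectation \<mu> (\<lambda>\<eta>. f \<eta> * of_bool (\<eta> a = k a)) =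
        measure_pmf.expectation \<nu> (\<lambda>\<eta>. f \<eta> * of_bool (\<eta> a = k a))"
    proof (rule powser_coeffs_unique[where a = "\<lambda>n. measure_pmf.expectation \<mu> (\<lambda>\<eta>. f \<eta> * of_bool (\<eta> a = n))"
          and b = "\<lambda>n. measure_pmf.expectation \<nu> (\<lambda>\<eta>. f \<eta> * of_bool (\<eta> a = n))"])
      fix t :: real assume "0 \<le> t" "t < 1"
      then show "(\<Sum>n. measure_pmf.expectation \<mu> (\<lambda>\<eta>. f \<eta> * of_bool (\<eta> a = n)) * t ^ n) =
          (\<Sum>n. measure_pmf.expectation \<nu> (\<lambda>\<eta>. f \<eta> * of_bool (\<eta> a = n)) * t ^ n)"
        using insert.IH[of "s(a := t)"] insert.prems
          expectation_power_sums[OF int, of t _ "\<lambda>\<eta>. \<eta> a"]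
        unfolding split by (auto simp: sums_iff)
    qed (auto intro!: sums_summable[OF expectation_power_sums[OF int]])
    moreover have "(\<Prod>i\<in>insert a A. of_bool (\<eta> i = k i)) * (\<Prod>i\<in>- insert a A. s i ^ \<eta> i) =
        f \<eta> * of_bool (\<eta> a = k a)" for \<eta>
      using insert.hyps by (simp add: f_def)
    ultimately show ?case by simp
  qed
  have "pmf \<kappa> k = measure_pmf.expectation \<kappa> (\<lambda>\<eta>. \<Prod>i\<in>UNIV. of_bool (\<eta> i = k i))" for \<kappa> and k :: "'v \<Rightarrow> nat"
  proof -
    have "(\<lambda>\<eta>. \<Prod>i\<in>UNIV. of_bool (\<eta> i = k i)) = (indicator {k} :: _ \<Rightarrow> real)"
      by (auto simp: fun_eq_iff indicator_def)
    then show ?thesis by (simp add: pmf.rep_eq)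
  qed
  then show ?thesis
    using key[of UNIV "\<lambda>_. 0"] by (intro pmf_eqI) simp
qed

subsection \<open>Uniqueness of the semigroup\<close>

lemma expectation_abs_le:
  fixes f :: "'a \<Rightarrow> real"
  assumes "\<And>x. \<bar>f x\<bar> \<le> C"
  shows "\<bar>measure_pmf.expectation p f\<bar> \<le> C"
proof -
  have "f x \<le> C" "- C \<le> f x" for x using assms[of x] by auto
  then show ?thesis
    using measure_pmf.integral_le_const[of p f C] measure_pmf.integral_ge_const[of p f "- C"]
      integrable_pmf_bounded[OF assms, of p]
    by (simp add: abs_le_iff)
qed

lemma expectation_bind:
  fixes f :: "'b \<Rightarrow> real"
  assumes "\<And>x. \<bar>f x\<bar> \<le> C"
  shows "measure_pmf.expectation (bind_pmf M N) f =
    measure_pmf.expectation M (\<lambda>x. measure_pmf.expectation (N x) f)"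
  unfolding measure_pmf_bind
  by (rule integral_bind[where K = "count_space UNIV" and B = C and B' = 1])
    (use assms measurable_measure_pmf[of N] in \<open>auto intro: measure_pmf.finite_measure\<close>)

text \<open>The integrand \<open>g y - g x\<close> vanishes at y = x and is at most 2 * B elsewhere,
  so only the mass that has left x counts.\<close>

lemma expectation_deviation_le:
  fixes g :: "'a \<Rightarrow> real"
  assumes g: "\<And>x. \<bar>g x\<bar> \<le> B"
  shows "\<bar>measure_pmf.expectation p g - g x\<bar> \<le> 2 * B * (1 - pmf p x)"
proof -
  have "measure_pmf.expectation p g - g x = measure_pmf.expectation p (\<lambda>y. g y - g x)"
    using integrable_pmf_bounded[OF g, of p] by (subst Bochner_Integration.integral_diff) auto
  also have "\<bar>\<dots>\<bar> \<le> measure_pmf.expectation p (\<lambda>y. \<bar>g y - g x\<bar>)"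
    by (rule integral_abs_bound)
  also have "\<dots> \<le> measure_pmf.expectation p (\<lambda>y. 2 * B * (1 - indicator {x} y))"
  proof (rule integral_mono)
    have diff: "\<bar>g y - g x\<bar> \<le> 2 * B" for y using g[of x] g[of y] by linarith
    then show "\<bar>g y - g x\<bar> \<le> 2 * B * (1 - indicator {x} y)" for y by (auto simp: indicator_def)
    show "integrable (measure_pmf p) (\<lambda>y. \<bar>g y - g x\<bar>)"
      by (rule integrable_pmf_bounded[of _ "2 * B"]) (use diff in auto)
  qed (auto intro!: integrable_pmf_bounded[of _ 1] simp: indicator_def)
  also have "\<dots> = 2 * B * (1 - pmf p x)"
  proof -
    have "measure_pmf.expectation p (\<lambda>y. 1 - indicator {x} y) = 1 - pmf p x"
      by (subst Bochner_Integration.integral_diff) (auto simp: pmf.rep_eq measure_pmf.emeasure_eq_measure)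
    then show ?thesis by simp
  qed
  finally show ?thesis .
qed

lemma markov_semigroup_expectation_add:
  fixes f :: "'a \<Rightarrow> real"
  assumes S: "markov_semigroup_of L S" and f: "\<And>x. \<bar>f x\<bar> \<le> C" and "0 \<le> s" "0 \<le> t"
  shows "measure_pmf.expectation (S (s + t) \<eta>) f =
    measure_pmf.expectation (S s \<eta>) (\<lambda>x. measure_pmf.expectation (S t x) f)"
proof -
  have "S (s + t) \<eta> = bind_pmf (S s \<eta>) (S t)"
    using assms by (simp add: markov_semigroup_of_def)
  then show ?thesis by (simp add: expectation_bind[OF f])
qed

lemma markov_semigroup_generator:
  fixes f :: "'a \<Rightarrow> real"
  assumes S: "markov_semigroup_of L S" and f: "\<And>x. \<bar>f x\<bar> \<le> C"
  shows "((\<lambda>t. measure_pmf.expectation (S t \<eta>) f) has_real_derivative L f \<eta>) (at 0 within {0..})"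
proof -
  have "bounded (range f)" using f by (auto simp: bounded_iff)
  then show ?thesis using S by (simp add: markov_semigroup_of_def)
qed

text \<open>Splitting a small time s off at the start applies the derivative at time 0 to the
  bounded function obtained by running for time t. Only a right derivative results.\<close>

lemma markov_semigroup_backward:
  fixes f :: "'a \<Rightarrow> real"
  assumes S: "markov_semigroup_of L S" and f: "\<And>x. \<bar>f x\<bar> \<le> C" and t: "0 \<le> t"
  shows "((\<lambda>t. measure_pmf.expectation (S t \<eta>) f) has_real_derivative
    L (\<lambda>x. measure_pmf.expectation (S t x) f) \<eta>) (at t within {t..})"
proof -
  let ?u = "\<lambda>t x. measure_pmf.expectation (S t x) f"
  have "((\<lambda>s. measure_pmf.expectation (S s \<eta>) (?u t)) has_real_derivative L (?u t) \<eta>) (at 0 within {0..})"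
    by (rule markov_semigroup_generator[OF S expectation_abs_le[OF f]])
  then have "((\<lambda>s. ?u (s + t) \<eta>) has_real_derivative L (?u t) \<eta>) (at 0 within {0..})"
    by (rule has_field_derivative_transform_within[where d = 1])
      (use t in \<open>auto simp: markov_semigroup_expectation_add[OF S f]\<close>)
  then have "((\<lambda>s. ?u (s + t) \<eta>) \<circ> (\<lambda>s. s - t) has_real_derivative L (?u t) \<eta> * 1) (at t within {t..})"
    by (intro DERIV_image_chain)
      (auto intro!: derivative_eq_intros elim!: has_field_derivative_subset)
  then show ?thesis by (simp add: o_def)
qed

text \<open>The value at t averages the function at s < t over the law at time t - s. It differs
  from its value at \<eta> by at most 2 * C times the probability of not being at \<eta> after time
  t - s, which tends to 0.\<close>

lemma markov_semigroup_left_continuous: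
  fixes f :: "'a \<Rightarrow> real"
  assumes S: "markov_semigroup_of L S" and f: "\<And>x. \<bar>f x\<bar> \<le> C" and t: "0 < t"
  shows "((\<lambda>t. measure_pmf.expectation (S t \<eta>) f) \<longlongrightarrow> measure_pmf.expectation (S t \<eta>) f) (at_left t)"
proof -
  let ?u = "\<lambda>t x. measure_pmf.expectation (S t x) f"
  have "((\<lambda>s. measure_pmf.expectation (S s \<eta>) (indicator {\<eta>})) has_real_derivative L (indicator {\<eta>}) \<eta>)
      (at 0 within {0..})"
    by (rule markov_semigroup_generator[OF S, of _ 1]) (auto simp: indicator_def)
  then have "((\<lambda>s. pmf (S s \<eta>) \<eta>) has_real_derivative L (indicator {\<eta>}) \<eta>) (at 0 within {0..})"
    by (simp add: pmf.rep_eq)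
  then have "((\<lambda>s. pmf (S s \<eta>) \<eta>) \<longlongrightarrow> pmf (S 0 \<eta>) \<eta>) (at 0 within {0..})"
    using DERIV_continuous continuous_within by blast
  moreover have "S 0 \<eta> = return_pmf \<eta>" using S by (simp add: markov_semigroup_of_def)
  ultimately have "((\<lambda>s. pmf (S s \<eta>) \<eta>) \<longlongrightarrow> 1) (at_right 0)"
    by (auto intro: tendsto_within_subset)
  then have "((\<lambda>s. pmf (S (t - s) \<eta>) \<eta>) \<longlongrightarrow> 1) (at_left t)"
    by (rule filterlim_compose) (auto simp: filterlim_at eventually_at_left_field
        intro!: tendsto_eq_intros exI[of _ "t - 1"])
  then have "((\<lambda>s. 2 * C * (1 - pmf (S (t - s) \<eta>) \<eta>)) \<longlongrightarrow> 2 * C * (1 - 1)) (at_left t)"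
    by (intro tendsto_intros)
  then have "((\<lambda>s. 2 * C * (1 - pmf (S (t - s) \<eta>) \<eta>)) \<longlongrightarrow> 0) (at_left t)" by simp
  then have "((\<lambda>s. ?u s \<eta> - ?u t \<eta>) \<longlongrightarrow> 0) (at_left t)"
  proof (rule Lim_null_comparison[rotated])
    show "\<forall>\<^sub>F s in at_left t. norm (?u s \<eta> - ?u t \<eta>) \<le> 2 * C * (1 - pmf (S (t - s) \<eta>) \<eta>)"
      unfolding eventually_at_left_field
    proof (intro exI[of _ 0] conjI allI impI)
      fix s assume "0 < s" "s < t"
      then have "?u t \<eta> = measure_pmf.expectation (S (t - s) \<eta>) (?u s)"
        using markov_semigroup_expectation_add[OF S f, of "t - s" s \<eta>] by simp
      then show "norm (?u s \<eta> - ?u t \<eta>) \<le> 2 * C * (1 - pmf (S (t - s) \<eta>) \<eta>)"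
        using expectation_deviation_le[of "?u s" C "S (t - s) \<eta>" \<eta>] expectation_abs_le[where f = f, OF f]
        by (simp add: abs_minus_commute)
    qed (rule t)
  qed
  then show ?thesis by (simp add: LIM_zero_iff)
qed

section \<open>Maximum principle for the backward equation\<close>

lemma walk_edge_diff: "walk_edge i j (\<lambda>x. f x - g x) \<eta> = walk_edge i j f \<eta> - walk_edge i j g \<eta>"
  by (simp add: walk_edge_def algebra_simps)

lemma walk_site_diff: "walk_site a b i (\<lambda>x. f x - g x) \<eta> = walk_site a b i f \<eta> - walk_site a b i g \<eta>"
  by (simp add: walk_site_def algebra_simps)

lemma walk_gen_diff:
  "walk_gen p c \<alpha> \<gamma> (\<lambda>x. f x - g x) \<eta> = walk_gen p c \<alpha> \<gamma> f \<eta> - walk_gen p c \<alpha> \<gamma> g \<eta>"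
  by (simp add: walk_gen_def walk_edge_diff walk_site_diff right_diff_distrib sum_subtractf)

lemma walk_edge_affine: "walk_edge i j (\<lambda>x. e * (f x + k)) \<eta> = e * walk_edge i j f \<eta>"
  by (simp add: walk_edge_def algebra_simps)

lemma walk_site_affine: "walk_site a b i (\<lambda>x. e * (f x + k)) \<eta> = e * walk_site a b i f \<eta>"
  by (simp add: walk_site_def algebra_simps)

lemma walk_gen_affine:
  "walk_gen p c \<alpha> \<gamma> (\<lambda>x. e * (f x + k)) \<eta> = e * walk_gen p c \<alpha> \<gamma> f \<eta>"
  by (simp only: walk_gen_def walk_edge_affine walk_site_affine) (simp add: distrib_left sum_distrib_left mult_ac)

context boundary_walk
begin

abbreviation "L \<equiv> walk_gen p c \<alpha> \<gamma>"

lemma walk_gen_max_le: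
  assumes "\<And>\<xi>. f \<xi> \<le> f \<eta>"
  shows "L f \<eta> \<le> 0"
proof -
  have "walk_edge i j f \<eta> \<le> 0" for i j
    using assms by (auto simp: walk_edge_def intro!: add_nonpos_nonpos mult_nonneg_nonpos)
  moreover have "walk_site (\<alpha> i) (\<gamma> i) i f \<eta> \<le> 0" for i
    using assms \<alpha>_nonneg[of i] \<gamma>_pos[of i]
    by (auto simp: walk_site_def intro!: add_nonpos_nonpos mult_nonneg_nonpos)
  ultimately show ?thesis
    by (auto simp: walk_gen_def p_nonneg c_nonneg intro!: add_nonpos_nonpos sum_nonpos mult_nonneg_nonpos)
qed

text \<open>The summand 1 keeps the Lyapunov function positive at the empty configuration, so that
  the barrier can be divided by.\<close>

definition mass :: "('v \<Rightarrow> nat) \<Rightarrow> real" where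
  "mass \<eta> = 1 + (\<Sum>i\<in>UNIV. real (\<eta> i))"

lemma mass_upd: "mass (\<eta>(i := n)) = mass \<eta> + real n - real (\<eta> i)"
  by (simp add: mass_def sum.remove[OF finite UNIV_I, of _ i])

text \<open>Edge jumps conserve the number of particles and absorption lowers it, so only
  immigration can increase the mass, at a rate independent of the configuration.\<close>

lemma walk_gen_mass_le: "L mass \<eta> \<le> (\<Sum>i\<in>UNIV. c i * \<alpha> i)"
proof -
  have "walk_edge i j mass \<eta> = 0" if "i \<noteq> j" for i j
    using that by (cases "\<eta> i"; cases "\<eta> j") (auto simp: walk_edge_def mass_upd)
  then have "L mass \<eta> = (\<Sum>i\<in>UNIV. c i * walk_site (\<alpha> i) (\<gamma> i) i mass \<eta>)"
    by (auto simp: walk_gen_def intro!: sum.neutral)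
  also have "\<dots> \<le> (\<Sum>i\<in>UNIV. c i * \<alpha> i)"
  proof (intro sum_mono mult_left_mono c_nonneg)
    fix i
    have "\<gamma> i * real (\<eta> i) * (real (\<eta> i - 1) - real (\<eta> i)) \<le> 0"
      using \<gamma>_pos[of i] by (intro mult_nonneg_nonpos) auto
    then show "walk_site (\<alpha> i) (\<gamma> i) i mass \<eta> \<le> \<alpha> i"
      by (simp add: walk_site_def mass_upd)
  qed
  finally show ?thesis .
qed

lemma finite_mass_less: "finite {\<eta>. mass \<eta> < K}"
proof (rule finite_subset)
  show "{\<eta>. mass \<eta> < K} \<subseteq> (\<Pi>\<^sub>E i\<in>UNIV. {..nat \<lceil>K\<rceil>})"
  proof
    fix \<eta> assume "\<eta> \<in> {\<eta>. mass \<eta> < K}"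
    moreover have "real (\<eta> i) \<le> (\<Sum>i\<in>UNIV. real (\<eta> i))" for i
      by (rule member_le_sum) auto
    ultimately have "real (\<eta> i) \<le> K" for i
      by (auto simp: mass_def) (smt (verit) \<open>\<And>i. real (\<eta> i) \<le> (\<Sum>i\<in>UNIV. real (\<eta> i))\<close>)
    then have "\<eta> i \<le> nat \<lceil>K\<rceil>" for i by (metis le_nat_iff nat_ceiling_le_eq real_nat_ceiling_ge of_nat_le_iff order_trans)
    then show "\<eta> \<in> (\<Pi>\<^sub>E i\<in>UNIV. {..nat \<lceil>K\<rceil>})" by auto
  qed
  show "finite (\<Pi>\<^sub>E i\<in>(UNIV :: 'v set). {..nat \<lceil>K\<rceil>})" by (intro finite_PiE) auto
qed

text \<open>
  Subtracting \<open>e * (mass + (C + 1) * t)\<close> confines the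
  positive values to a finite set of configurations and makes the right derivative strictly negative
  at a first zero.
\<close>

lemma backward_max_principle:
  fixes u :: "real \<Rightarrow> ('v \<Rightarrow> nat) \<Rightarrow> real"
  assumes u0: "\<And>\<eta>. u 0 \<eta> \<le> 0" and bound: "\<And>t \<eta>. 0 \<le> t \<Longrightarrow> u t \<eta> \<le> B"
    and right: "\<And>t \<eta>. 0 \<le> t \<Longrightarrow> ((\<lambda>t. u t \<eta>) has_real_derivative L (u t) \<eta>) (at t within {t..})"
    and left: "\<And>t \<eta>. 0 < t \<Longrightarrow> ((\<lambda>t. u t \<eta>) \<longlongrightarrow> u t \<eta>) (at_left t)"
    and "0 \<le> t"
  shows "u t \<eta> \<le> 0"
proof -
  \<comment> \<open>The 1 exceeds the bound on \<open>L mass\<close>; it leaves the slack - e that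
    makes the derivative strictly negative.\<close>
  define C where "C = (\<Sum>i\<in>UNIV. c i * \<alpha> i) + 1"
  have C: "0 \<le> C" by (auto simp: C_def c_nonneg \<alpha>_nonneg intro!: add_nonneg_nonneg sum_nonneg)
  have mass1: "1 \<le> mass \<eta>" for \<eta> by (simp add: mass_def sum_nonneg)
  have barrier: "u t \<eta> \<le> e * (mass \<eta> + C * t)" if "0 < e" "0 \<le> t" for e t \<eta>
  proof (rule ccontr)
    assume contra: "\<not> u t \<eta> \<le> e * (mass \<eta> + C * t)"
    define w where "w s \<xi> = u s \<xi> - e * (mass \<xi> + C * s)" for s \<xi>
    have w_right: "((\<lambda>s. w s \<xi>) has_real_derivative L (u s) \<xi> - e * C) (at s within {s..})" if "0 \<le> s" for s \<xi>
      unfolding w_def by (rule derivative_eq_intros right[OF that] refl)+ (simp add: algebra_simps)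
    have w_left: "((\<lambda>s. w s \<xi>) \<longlongrightarrow> w s \<xi>) (at_left s)" if "0 < s" for s \<xi>
      unfolding w_def by (intro tendsto_intros left[OF that])
    define good where "good s \<longleftrightarrow> (\<forall>r\<in>{0..s}. \<forall>\<xi>. w r \<xi> \<le> 0)" for s
    define A where "A = {s \<in> {0..t}. good s}"
    define T where "T = Sup A"
    have "w 0 \<xi> \<le> 0" for \<xi>
    proof -
      have "0 \<le> e * mass \<xi>" using mass1[of \<xi>] \<open>0 < e\<close> by simp
      then show ?thesis using u0[of \<xi>] by (simp add: w_def)
    qed
    then have "0 \<in> A" using that by (auto simp: A_def good_def)
    have bdd: "bdd_above A" by (auto simp: A_def)
    have "0 \<le> T" unfolding T_def by (rule cSup_upper[OF \<open>0 \<in> A\<close> bdd])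
    have "T \<le> t" unfolding T_def by (rule cSup_least) (use \<open>0 \<in> A\<close> in \<open>auto simp: A_def\<close>)
    have before: "w r \<xi> \<le> 0" if "0 \<le> r" and r: "r < T" for r \<xi>
    proof -
      have "A \<noteq> {}" using \<open>0 \<in> A\<close> by blast
      then obtain s where "s \<in> A" "r < s" using r less_cSup_iff[OF _ bdd, of r] by (auto simp: T_def)
      then show ?thesis using \<open>0 \<le> r\<close> by (auto simp: A_def good_def)
    qed
    have at_T: "w T \<xi> \<le> 0" for \<xi>
    proof (cases "T = 0")
      case False
      then have "0 < T" using \<open>0 \<le> T\<close> by simp
      show ?thesis
      proof (rule tendsto_upperbound[OF w_left[OF \<open>0 < T\<close>]])
        show "\<forall>\<^sub>F r in at_left T. w r \<xi> \<le> 0"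
          unfolding eventually_at_left_field using \<open>0 < T\<close> before by (auto intro!: exI[of _ 0])
      qed simp
    qed (use \<open>\<And>\<xi>. w 0 \<xi> \<le> 0\<close> in simp)
    have after: "\<forall>\<^sub>F r in at_right T. w r \<xi> \<le> 0" for \<xi>
    proof (cases "w T \<xi> = 0")
      case True
      have "L (u T) \<xi> = L (w T) \<xi> + e * L mass \<xi>"
      proof -
        have "w T = (\<lambda>x. u T x - e * (mass x + C * T))" by (simp add: w_def fun_eq_iff)
        then show ?thesis by (simp only: walk_gen_diff walk_gen_affine diff_add_cancel)
      qed
      \<comment> \<open>Since \<open>w T\<close> is nonpositive everywhere, a zero of it is a global
        maximum.\<close>
      moreover have "L (w T) \<xi> \<le> 0" using at_T True by (intro walk_gen_max_le) simp
      moreover have "e * L mass \<xi> \<le> e * (C - 1)"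
        using walk_gen_mass_le[of \<xi>] \<open>0 < e\<close> by (intro mult_left_mono) (auto simp: C_def)
      ultimately have "L (u T) \<xi> - e * C < 0" using \<open>0 < e\<close> by (simp add: algebra_simps)
      from has_real_derivative_neg_dec_right[OF w_right[OF \<open>0 \<le> T\<close>] this]
      obtain d where "d > 0" "\<And>h. 0 < h \<Longrightarrow> h < d \<Longrightarrow> w (T + h) \<xi> < w T \<xi>" by auto
      then have "w r \<xi> \<le> 0" if "T < r" "r < T + d" for r
        using that True \<open>\<And>h. 0 < h \<Longrightarrow> h < d \<Longrightarrow> w (T + h) \<xi> < w T \<xi>\<close>[of "r - T"] by simp
      then show ?thesis
        unfolding eventually_at_right_field using \<open>d > 0\<close> by (auto intro!: exI[of _ "T + d"])
    next
      case False
      then have "w T \<xi> < 0" using at_T[of \<xi>] by simp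
      moreover have "((\<lambda>s. w s \<xi>) \<longlongrightarrow> w T \<xi>) (at_right T)"
        using DERIV_continuous[OF w_right[OF \<open>0 \<le> T\<close>, of \<xi>]]
        by (auto simp: continuous_within intro: tendsto_within_subset)
      ultimately have "\<forall>\<^sub>F r in at_right T. w r \<xi> < 0" by (rule order_tendstoD(2)[rotated])
      then show ?thesis by eventually_elim simp
    qed
    \<comment> \<open>Finiteness turns the neighbourhoods of T, one per configuration, into a common
      one.\<close>
    have "\<forall>\<^sub>F r in at_right T. \<forall>\<xi>\<in>{\<xi>. mass \<xi> < B / e}. w r \<xi> \<le> 0"
      using after by (intro eventually_ball_finite finite_mass_less) auto
    then obtain b where "T < b" and b: "\<And>r \<xi>. T < r \<Longrightarrow> r < b \<Longrightarrow> mass \<xi> < B / e \<Longrightarrow> w r \<xi> \<le> 0"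
      unfolding eventually_at_right_field by blast
    have far: "w r \<xi> \<le> 0" if "\<not> mass \<xi> < B / e" "0 \<le> r" for r \<xi>
    proof -
      have "B \<le> e * mass \<xi>" using that \<open>0 < e\<close> by (simp add: field_simps)
      moreover have "0 \<le> e * (C * r)" using C that \<open>0 < e\<close> by simp
      ultimately show ?thesis using bound[OF \<open>0 \<le> r\<close>, of \<xi>] by (simp add: w_def distrib_left)
    qed
    \<comment> \<open>The midpoint lies beyond T but before b. As s belongs to A, it cannot exceed
      T, which leaves only s = t.\<close>
    define s where "s = min t ((T + b) / 2)"
    have "good s"
      unfolding good_def
    proof (intro ballI allI)
      fix r \<xi> assume r: "r \<in> {0..s}"
      then have "r < b" using \<open>T < b\<close> by (auto simp: s_def)
      then show "w r \<xi> \<le> 0"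
        using r before[of r \<xi>] at_T[of \<xi>] b[of r \<xi>] far[of \<xi> r] by (cases r T rule: linorder_cases) auto
    qed
    moreover have "0 \<le> s" using \<open>0 \<le> T\<close> \<open>T < b\<close> \<open>0 \<le> t\<close> by (simp add: s_def)
    ultimately have "s \<in> A" by (simp add: A_def s_def)
    then have "s \<le> T" unfolding T_def by (rule cSup_upper[OF _ bdd])
    then have "s = t" using \<open>T < b\<close> by (auto simp: s_def min_def split: if_splits)
    then have "w t \<eta> \<le> 0" using \<open>good s\<close> \<open>0 \<le> t\<close> by (auto simp: good_def)
    with contra show False by (simp add: w_def)
  qed
  have pos: "0 < mass \<eta> + C * t" using mass1[of \<eta>] C \<open>0 \<le> t\<close> by (simp add: add_pos_nonneg)
  show ?thesis
  proof (rule field_le_epsilon)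
    fix e :: real assume "0 < e"
    then show "u t \<eta> \<le> 0 + e"
      using barrier[of "e / (mass \<eta> + C * t)" t \<eta>] pos \<open>0 \<le> t\<close> by simp
  qed
qed

text \<open>By linearity of \<open>L\<close> the difference of the two expectations solves the
  backward equation, starting from 0. Exchanging the semigroups then gives equality.\<close>

lemma markov_semigroup_le:
  fixes f :: "('v \<Rightarrow> nat) \<Rightarrow> real"
  assumes S: "markov_semigroup_of L S" and S': "markov_semigroup_of L S'"
    and f: "\<And>x. \<bar>f x\<bar> \<le> C" and "0 \<le> t"
  shows "measure_pmf.expectation (S t \<eta>) f \<le> measure_pmf.expectation (S' t \<eta>) f"
proof -
  define u where "u t x = measure_pmf.expectation (S t x) f - measure_pmf.expectation (S' t x) f" for t x
  have "u t \<eta> \<le> 0"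
  proof (rule backward_max_principle[OF _ _ _ _ \<open>0 \<le> t\<close>])
    show "u 0 \<eta> \<le> 0" for \<eta> using S S' by (simp add: u_def markov_semigroup_of_def)
    show "u t \<eta> \<le> 2 * C" for t \<eta>
      using expectation_abs_le[of f C "S t \<eta>", OF f] expectation_abs_le[of f C "S' t \<eta>", OF f]
      by (simp add: u_def)
    show "((\<lambda>t. u t \<eta>) has_real_derivative L (u t) \<eta>) (at t within {t..})" if "0 \<le> t" for t \<eta>
      using markov_semigroup_backward[OF S f that] markov_semigroup_backward[OF S' f that]
      unfolding u_def by (subst walk_gen_diff) (rule DERIV_diff)
    show "((\<lambda>t. u t \<eta>) \<longlongrightarrow> u t \<eta>) (at_left t)" if "0 < t" for t \<eta>
      unfolding u_def
      by (intro tendsto_diff markov_semigroup_left_continuous[OF S f that] markov_semigroup_left_continuous[OF S' f that])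
  qed
  then show ?thesis by (simp add: u_def)
qed

theorem markov_semigroup_unique:
  assumes S: "markov_semigroup_of L S" and S': "markov_semigroup_of L S'" and "0 \<le> t"
  shows "S t \<eta> = S' t \<eta>"
proof (rule pmf_eqI)
  fix \<xi> :: "'v \<Rightarrow> nat"
  have bound: "\<bar>indicator {\<xi>} x :: real\<bar> \<le> 1" for x :: "'v \<Rightarrow> nat" by (simp add: indicator_def)
  from markov_semigroup_le[where f = "indicator {\<xi>}", OF S S' bound \<open>0 \<le> t\<close>, of \<eta>]
    markov_semigroup_le[where f = "indicator {\<xi>}", OF S' S bound \<open>0 \<le> t\<close>, of \<eta>]
  show "pmf (S t \<eta>) \<xi> = pmf (S' t \<eta>) \<xi>"
    by (intro antisym) (simp_all add: pmf.rep_eq)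
qed

end

subsection \<open>Construction of the semigroup\<close>

lemma deriv_zero_squeeze:
  fixes r b :: "real \<Rightarrow> real"
  assumes b: "(b has_real_derivative 0) (at 0 within S)" and "b 0 = 0"
    and r: "\<And>t. t \<in> S \<Longrightarrow> \<bar>r t\<bar> \<le> b t" and "r 0 = 0"
  shows "(r has_real_derivative 0) (at 0 within S)"
  unfolding has_field_derivative_iff
proof (rule Lim_null_comparison)
  have "((\<lambda>t. b t / t) \<longlongrightarrow> 0) (at 0 within S)"
    using b \<open>b 0 = 0\<close> by (simp add: has_field_derivative_iff)
  then show "((\<lambda>t. \<bar>b t / t\<bar>) \<longlongrightarrow> 0) (at 0 within S)" by (rule tendsto_rabs_zero)
  have "norm ((r t - r 0) / (t - 0)) \<le> \<bar>b t / t\<bar>" if "t \<in> S" for t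
    using divide_right_mono[OF order_trans[OF r[OF that] abs_ge_self], of "\<bar>t\<bar>"] \<open>r 0 = 0\<close> by simp
  then show "\<forall>\<^sub>F t in at 0 within S. norm ((r t - r 0) / (t - 0)) \<le> \<bar>b t / t\<bar>"
    by (auto simp: eventually_at intro!: exI[of _ 1])
qed

text \<open>The generator condition at a single starting state x, with \<open>Q\<close> the
  generator evaluated there. In this form it passes to images and independent pairs, so it can be
  assembled particle by particle.\<close>

definition generates :: "(real \<Rightarrow> 'a pmf) \<Rightarrow> 'a \<Rightarrow> (('a \<Rightarrow> real) \<Rightarrow> real) \<Rightarrow> bool" where
  "generates p x Q \<longleftrightarrow> p 0 = return_pmf x \<and>
     (\<forall>f C. (\<forall>y. \<bar>f y\<bar> \<le> C) \<longrightarrow>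
       ((\<lambda>t. measure_pmf.expectation (p t) f) has_real_derivative Q f) (at 0 within {0..}))"

lemma generatesD:
  assumes "generates p x Q"
  shows "p 0 = return_pmf x"
    and "(\<And>y. \<bar>f y\<bar> \<le> C) \<Longrightarrow>
      ((\<lambda>t. measure_pmf.expectation (p t) f) has_real_derivative Q f) (at 0 within {0..})"
  using assms unfolding generates_def by blast+

lemma generates_cong:
  assumes "generates p x Q" "\<And>t. 0 \<le> t \<Longrightarrow> p' t = p t" "\<And>f. Q' f = Q f"
  shows "generates p' x Q'"
  unfolding generates_def
proof (intro conjI allI impI)
  fix f :: "'a \<Rightarrow> real" and C assume "\<forall>y. \<bar>f y\<bar> \<le> C"
  then have "((\<lambda>t. measure_pmf.expectation (p t) f) has_real_derivative Q f) (at 0 within {0..})"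
    by (intro generatesD(2)[OF assms(1)]) auto
  then show "((\<lambda>t. measure_pmf.expectation (p' t) f) has_real_derivative Q' f) (at 0 within {0..})"
    unfolding assms(3)
    by (rule has_field_derivative_transform_within[where d = 1]) (use assms(2) in auto)
qed (use assms generatesD(1)[OF assms(1)] in simp)

lemma generates_map:
  fixes h :: "'a \<Rightarrow> 'b"
  assumes "generates p x Q"
  shows "generates (\<lambda>t. map_pmf h (p t)) (h x) (\<lambda>f. Q (\<lambda>y. f (h y)))"
  unfolding generates_def
proof (intro conjI allI impI)
  fix f :: "'b \<Rightarrow> real" and C assume "\<forall>z. \<bar>f z\<bar> \<le> C"
  then have "((\<lambda>t. measure_pmf.expectation (p t) (\<lambda>y. f (h y))) has_real_derivative Q (\<lambda>y. f (h y))) (at 0 within {0..})"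
    by (intro generatesD(2)[OF assms, of _ C]) auto
  then show "((\<lambda>t. measure_pmf.expectation (map_pmf h (p t)) f) has_real_derivative Q (\<lambda>y. f (h y))) (at 0 within {0..})"
    by simp
qed (simp add: generatesD(1)[OF assms])

lemma generates_pmf_deriv:
  assumes p: "generates p x Q"
  shows "((\<lambda>t. pmf (p t) y) has_real_derivative Q (indicator {y})) (at 0 within {0..})"
proof -
  have "((\<lambda>t. measure_pmf.expectation (p t) (indicator {y})) has_real_derivative Q (indicator {y})) (at 0 within {0..})"
    by (rule generatesD(2)[OF p, of _ 1]) (simp add: indicator_def)
  then show ?thesis by (simp add: pmf.rep_eq)
qed

lemma expectation_pair:
  fixes f :: "'a \<times> 'b \<Rightarrow> real"
  assumes f: "\<And>z. \<bar>f z\<bar> \<le> C"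
  shows "measure_pmf.expectation (pair_pmf M N) f =
    measure_pmf.expectation M (\<lambda>x. measure_pmf.expectation N (\<lambda>y. f (x, y)))"
proof -
  have "pair_pmf M N = bind_pmf M (\<lambda>x. map_pmf (Pair x) N)"
    by (simp add: pair_pmf_def map_pmf_def)
  then show ?thesis by (simp add: expectation_bind[OF f])
qed

text \<open>To first order only one component moves. The remainder \<open>r\<close>, where both do,
  is bounded by a multiple of the product of the two exit probabilities; both factors vanish at 0,
  so the product has derivative 0.\<close>

lemma generates_pair:
  assumes p: "generates p x Q" and q: "generates q y R"
  shows "generates (\<lambda>t. pair_pmf (p t) (q t)) (x, y) (\<lambda>f. Q (\<lambda>a. f (a, y)) + R (\<lambda>b. f (x, b)))"
  unfolding generates_def
proof (intro conjI allI impI)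
  show "pair_pmf (p 0) (q 0) = return_pmf (x, y)"
    by (simp add: generatesD(1)[OF p] generatesD(1)[OF q])
  fix f :: "'a \<times> 'b \<Rightarrow> real" and C assume "\<forall>z. \<bar>f z\<bar> \<le> C"
  then have f: "\<bar>f z\<bar> \<le> C" for z by blast
  define k where "k t a = measure_pmf.expectation (q t) (\<lambda>b. f (a, b)) - f (a, y)" for t a
  define r where "r t = measure_pmf.expectation (p t) (k t) - k t x" for t
  define b where "b t = 2 * (2 * C * (1 - pmf (q t) y)) * (1 - pmf (p t) x)" for t
  have k: "\<bar>k t a\<bar> \<le> 2 * C * (1 - pmf (q t) y)" for t a
    unfolding k_def by (rule expectation_deviation_le) (rule f)
  have "(b has_real_derivative 0) (at 0 within {0..})"
    unfolding b_def
    by (rule derivative_eq_intros generates_pmf_deriv[OF p] generates_pmf_deriv[OF q] refl)+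
      (simp add: generatesD(1)[OF p] generatesD(1)[OF q])
  then have r: "(r has_real_derivative 0) (at 0 within {0..})"
  proof (rule deriv_zero_squeeze)
    show "\<bar>r t\<bar> \<le> b t" for t unfolding r_def b_def by (rule expectation_deviation_le[OF k])
  qed (simp_all add: b_def r_def generatesD(1)[OF p])
  have split: "measure_pmf.expectation (pair_pmf (p t) (q t)) f =
      measure_pmf.expectation (p t) (\<lambda>a. f (a, y)) + (measure_pmf.expectation (q t) (\<lambda>b. f (x, b)) - f (x, y)) + r t" for t
  proof -
    have "measure_pmf.expectation (pair_pmf (p t) (q t)) f =
        measure_pmf.expectation (p t) (\<lambda>a. f (a, y) + k t a)"
      by (simp add: expectation_pair[OF f] k_def)
    also have "\<dots> = measure_pmf.expectation (p t) (\<lambda>a. f (a, y)) + measure_pmf.expectation (p t) (k t)"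
      by (intro Bochner_Integration.integral_add integrable_pmf_bounded[OF k] integrable_pmf_bounded[of _ C] f)
    finally show ?thesis by (simp add: r_def k_def)
  qed
  have "((\<lambda>t. measure_pmf.expectation (p t) (\<lambda>a. f (a, y)) +
      (measure_pmf.expectation (q t) (\<lambda>b. f (x, b)) - f (x, y)) + r t) has_real_derivative
      Q (\<lambda>a. f (a, y)) + (R (\<lambda>b. f (x, b)) - 0) + 0) (at 0 within {0..})"
    by (intro DERIV_add DERIV_diff DERIV_const r generatesD(2)[OF p, of _ C] generatesD(2)[OF q, of _ C] f)
  then show "((\<lambda>t. measure_pmf.expectation (pair_pmf (p t) (q t)) f) has_real_derivative
      Q (\<lambda>a. f (a, y)) + R (\<lambda>b. f (x, b))) (at 0 within {0..})"
    by (simp only: split) simp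
qed

text \<open>
  If the derivatives of the point masses at finitely many points add up to \<open>0\<close>, then the mass
  outside these points is \<open>o(t)\<close>.
\<close>

lemma generates_of_pmf_deriv:
  fixes y :: "'i \<Rightarrow> 'a"
  assumes "finite I" "inj_on y I" "i0 \<in> I" and p0: "p 0 = return_pmf (y i0)"
    and d: "\<And>i. i \<in> I \<Longrightarrow> ((\<lambda>t. pmf (p t) (y i)) has_real_derivative q i) (at 0 within {0..})"
    and q: "sum q I = 0"
  shows "generates p (y i0) (\<lambda>f. \<Sum>i\<in>I. q i * f (y i))"
  unfolding generates_def
proof (intro conjI allI impI)
  fix f :: "'a \<Rightarrow> real" and C assume "\<forall>z. \<bar>f z\<bar> \<le> C"
  then have f: "\<bar>f z\<bar> \<le> C" for z by blast
  let ?F = "y ` I"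
  define r where "r t = measure_pmf.expectation (p t) (\<lambda>z. f z * indicator (- ?F) z)" for t
  have prob: "measure_pmf.prob (p t) ?F = (\<Sum>i\<in>I. pmf (p t) (y i))" for t
    using assms(1,2) by (simp add: measure_measure_pmf_finite sum.reindex)
  have "((\<lambda>t. C * (1 - (\<Sum>i\<in>I. pmf (p t) (y i)))) has_real_derivative C * (0 - (\<Sum>i\<in>I. q i))) (at 0 within {0..})"
    by (intro DERIV_cmult DERIV_diff DERIV_const DERIV_sum d)
  then have "((\<lambda>t. C * (1 - measure_pmf.prob (p t) ?F)) has_real_derivative 0) (at 0 within {0..})"
    by (simp add: prob q)
  then have r: "(r has_real_derivative 0) (at 0 within {0..})"
  proof (rule deriv_zero_squeeze)
    show "\<bar>r t\<bar> \<le> C * (1 - measure_pmf.prob (p t) ?F)" for t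
    proof -
      have "\<bar>r t\<bar> \<le> measure_pmf.expectation (p t) (\<lambda>z. \<bar>f z * indicator (- ?F) z\<bar>)"
        unfolding r_def by (rule integral_abs_bound)
      also have "\<dots> \<le> measure_pmf.expectation (p t) (\<lambda>z. C * indicator (- ?F) z)"
        using f order_trans[OF abs_ge_zero f]
        by (intro integral_mono integrable_pmf_bounded[of _ C]) (auto simp: indicator_def)
      also have "\<dots> = C * measure_pmf.prob (p t) (- ?F)" by simp
      also have "measure_pmf.prob (p t) (- ?F) = 1 - measure_pmf.prob (p t) ?F"
        using measure_pmf.prob_compl[of ?F "p t"] by (simp add: Compl_eq_Diff_UNIV)
      finally show ?thesis .
    qed
  qed (use \<open>i0 \<in> I\<close> in \<open>simp_all add: p0 r_def\<close>)
  have split: "measure_pmf.expectation (p t) f = (\<Sum>i\<in>I. pmf (p t) (y i) * f (y i)) + r t" for t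
  proof -
    have "measure_pmf.expectation (p t) f =
        measure_pmf.expectation (p t) (\<lambda>z. f z * indicator ?F z + f z * indicator (- ?F) z)"
      by (intro Bochner_Integration.integral_cong) (auto simp: indicator_def)
    also have "\<dots> = measure_pmf.expectation (p t) (\<lambda>z. f z * indicator ?F z) + r t"
      unfolding r_def
      by (intro Bochner_Integration.integral_add integrable_pmf_mult_bounded[of _ _ _ 1] integrable_pmf_bounded[OF f])
        (auto simp: indicator_def)
    also have "measure_pmf.expectation (p t) (\<lambda>z. f z * indicator ?F z) = (\<Sum>z\<in>?F. f z * indicator ?F z * pmf (p t) z)"
      using assms(1) by (intro integral_measure_pmf_real) (auto simp: indicator_def split: if_splits)
    also have "\<dots> = (\<Sum>i\<in>I. pmf (p t) (y i) * f (y i))"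
      by (simp add: sum.reindex[OF assms(2)] mult.commute)
    finally show ?thesis .
  qed
  have "((\<lambda>t. (\<Sum>i\<in>I. pmf (p t) (y i) * f (y i)) + r t) has_real_derivative (\<Sum>i\<in>I. q i * f (y i)) + 0) (at 0 within {0..})"
    by (intro DERIV_add r DERIV_sum DERIV_cmult_right d)
  then show "((\<lambda>t. measure_pmf.expectation (p t) f) has_real_derivative (\<Sum>i\<in>I. q i * f (y i))) (at 0 within {0..})"
    by (simp add: split)
qed (rule p0)

section \<open>Kernels by superposition of independent particles\<close>

definition settle :: "'v option \<Rightarrow> ('v \<Rightarrow> nat) \<Rightarrow> 'v \<Rightarrow> nat" where
  "settle z \<eta> = (case z of None \<Rightarrow> \<eta> | Some j \<Rightarrow> \<eta>(j := \<eta> j + 1))"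

lemma settle_simps [simp]: "settle None \<eta> = \<eta>" "settle (Some j) \<eta> = \<eta>(j := \<eta> j + 1)"
  by (simp_all add: settle_def)

lemma thinning_settle:
  "thinning g (settle z \<eta>) = (case z of None \<Rightarrow> 1 | Some j \<Rightarrow> 1 - g $ j) * thinning g \<eta>"
  by (cases z) (simp_all add: thinning_def prod.remove[OF finite UNIV_I, of _ "the z"])

lemma configuration_induct [case_names zero add]:
  fixes \<eta> :: "'v::finite \<Rightarrow> nat"
  assumes "P (\<lambda>_. 0)" "\<And>\<eta> i. P \<eta> \<Longrightarrow> P (\<eta>(i := \<eta> i + 1))"
  shows "P \<eta>"
proof (induction "\<Sum>i\<in>UNIV. \<eta> i" arbitrary: \<eta>)
  case 0
  then have "\<eta> = (\<lambda>_. 0)" by auto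
  then show ?case using assms(1) by simp
next
  case (Suc n)
  then obtain i where i: "\<eta> i > 0" by (metis Zero_not_Suc gr0I sum.neutral)
  have "(\<Sum>k\<in>UNIV. (\<eta>(i := \<eta> i - 1)) k) = n"
    using Suc(2) i by (simp add: sum.remove[OF finite UNIV_I, of _ i])
  then have "P (\<eta>(i := \<eta> i - 1))" using Suc(1) by blast
  from assms(2)[OF this, of i] show ?case using i by simp
qed

lemma sum_option: "(\<Sum>z\<in>(UNIV :: 'v::finite option set). f z) = f None + (\<Sum>j\<in>UNIV. f (Some j) :: real)"
  by (simp add: UNIV_option_conv sum.reindex)

context boundary_walk
begin

lemma P_sum:
  assumes "0 \<le> t"
  shows "P t (\<Sum>j\<in>J. x j) = (\<Sum>j\<in>J. P t (x j))"
proof (induction J rule: infinite_finite_induct)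
  case (insert j J)
  then show ?case by (simp add: P_plus assms)
qed (use P_scaleR[OF assms, of 0 0] in simp_all)

lemma P_expand:
  assumes "0 \<le> t"
  shows "P t g $ i = (\<Sum>j\<in>UNIV. P t (axis j 1) $ i * g $ j)"
proof -
  have "g = (\<Sum>j\<in>UNIV. g $ j *\<^sub>R axis j 1)"
    using basis_expansion[of g] by (simp add: scalar_mult_eq_scaleR)
  then have "P t g = (\<Sum>j\<in>UNIV. g $ j *\<^sub>R P t (axis j 1))"
    using P_sum[OF assms, of "\<lambda>j. g $ j *\<^sub>R axis j 1" UNIV] by (simp add: P_scaleR assms)
  then show ?thesis by (simp add: mult.commute)
qed

text \<open>The law at time t of one walker started at i. \<open>None\<close> means that it has been
  absorbed and carries the mass missing from the sub-Markov \<open>P t\<close>.\<close>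

definition particle :: "real \<Rightarrow> 'v \<Rightarrow> 'v option pmf" where
  "particle t i = embed_pmf (case_option (1 - P t 1 $ i) (\<lambda>j. P t (axis j 1) $ i))"

lemma one_in_cube: "(1 :: real ^ 'v) \<in> {0..1}"
  by (simp add: less_eq_vec_def)

lemma pmf_particle:
  assumes t: "0 \<le> t"
  shows "pmf (particle t i) z = case_option (1 - P t 1 $ i) (\<lambda>j. P t (axis j 1) $ i) z"
  unfolding particle_def
proof (rule pmf_embed_pmf)
  let ?w = "case_option (1 - P t 1 $ i) (\<lambda>j. P t (axis j 1) $ i)"
  have "axis j 1 \<in> orthant" for j :: 'v by (simp add: orthant_def axis_def)
  then have "0 \<le> P t (axis j 1) $ i" for j using P_orthant[OF _ t] by (auto simp: orthant_def)
  moreover have "P t 1 $ i \<le> 1"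
    using P_cube[OF one_in_cube t] by (simp add: less_eq_vec_def)
  ultimately show nonneg: "0 \<le> ?w z" for z by (cases z) auto
  have "(\<Sum>z\<in>UNIV. ?w z) = 1"
    using P_expand[OF t, of 1 i] by (simp add: sum_option)
  then show "(\<integral>\<^sup>+z. ennreal (?w z) \<partial>count_space UNIV) = 1"
    by (simp add: nn_integral_count_space_finite sum_ennreal nonneg del: sum_ennreal)
      (simp add: sum_ennreal[OF nonneg])
qed

lemma expectation_particle:
  assumes "0 \<le> t"
  shows "measure_pmf.expectation (particle t i) (case_option 1 (\<lambda>j. 1 - g $ j)) = 1 - P t g $ i"
proof -
  have "measure_pmf.expectation (particle t i) (case_option 1 (\<lambda>j. 1 - g $ j)) =
      (\<Sum>z\<in>UNIV. case_option 1 (\<lambda>j. 1 - g $ j) z * pmf (particle t i) z)"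
    by (rule integral_measure_pmf_real) auto
  also have "\<dots> = 1 - P t 1 $ i + (\<Sum>j\<in>UNIV. (1 - g $ j) * P t (axis j 1) $ i)"
    by (simp add: sum_option pmf_particle assms)
  also have "\<dots> = 1 - P t g $ i"
    using P_expand[OF assms, of 1 i] P_expand[OF assms, of g i]
    by (simp add: left_diff_distrib sum_subtractf mult.commute)
  finally show ?thesis .
qed

definition transition_pgf :: "real \<Rightarrow> ('v \<Rightarrow> nat) \<Rightarrow> ('v \<Rightarrow> nat) pmf \<Rightarrow> bool" where
  "transition_pgf t \<eta> \<mu> \<longleftrightarrow> (\<forall>g\<in>{0..1}.
     measure_pmf.expectation \<mu> (thinning g) = thinning (P t g) \<eta> * exp (- (immigrants t \<bullet> g)))"

text \<open>Selecting the law by its generating function makes it independent of the order in which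
  particles are added, and reduces every identity between kernels to one between generating
  functions.\<close>

definition transition :: "real \<Rightarrow> ('v \<Rightarrow> nat) \<Rightarrow> ('v \<Rightarrow> nat) pmf" where
  "transition t \<eta> = (SOME \<mu>. transition_pgf t \<eta> \<mu>)"

lemma transition_pgf_zero: "0 \<le> t \<Longrightarrow> transition_pgf t (\<lambda>_. 0) (poisson_product (immigrants t))"
  by (auto simp: transition_pgf_def expectation_thinning_poisson_product immigrants_orthant thinning_def)

lemma abs_thinning_le: "g \<in> {0..1} \<Longrightarrow> \<bar>thinning g \<eta>\<bar> \<le> 1"
  using thinning_bounds[of g \<eta>] by simp

text \<open>An additional walker from i is independent of the rest and multiplies the generating
  function by the factor 1 - (P t g) i.\<close>

lemma transition_pgf_add:
  assumes "0 \<le> t" "transition_pgf t \<eta> \<mu>"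
  shows "transition_pgf t (\<eta>(i := \<eta> i + 1)) (map_pmf (case_prod settle) (pair_pmf (particle t i) \<mu>))"
  unfolding transition_pgf_def
proof
  fix g :: "real ^ 'v" assume g: "g \<in> {0..1}"
  have "measure_pmf.expectation (map_pmf (case_prod settle) (pair_pmf (particle t i) \<mu>)) (thinning g) =
      measure_pmf.expectation (particle t i) (\<lambda>z. measure_pmf.expectation \<mu> (\<lambda>x. thinning g (settle z x)))"
    unfolding integral_map_pmf
    by (subst expectation_pair[of _ 1]) (use abs_thinning_le[OF g] in \<open>auto simp: case_prod_beta\<close>)
  also have "\<dots> = (1 - P t g $ i) * measure_pmf.expectation \<mu> (thinning g)"
    using expectation_particle[OF assms(1), of i g] by (simp add: thinning_settle)
  also have "\<dots> = thinning (P t g) (\<eta>(i := \<eta> i + 1)) * exp (- (immigrants t \<bullet> g))"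
    using assms(2) g thinning_settle[of "P t g" "Some i" \<eta>] by (simp add: transition_pgf_def)
  finally show "measure_pmf.expectation (map_pmf (case_prod settle) (pair_pmf (particle t i) \<mu>)) (thinning g) =
      thinning (P t g) (\<eta>(i := \<eta> i + 1)) * exp (- (immigrants t \<bullet> g))" .
qed

lemma transition_pgf_transition:
  assumes "0 \<le> t"
  shows "transition_pgf t \<eta> (transition t \<eta>)"
proof -
  have "\<exists>\<mu>. transition_pgf t \<eta> \<mu>"
    by (induction \<eta> rule: configuration_induct) (use transition_pgf_zero transition_pgf_add assms in blast)+
  then show ?thesis unfolding transition_def by (rule someI_ex)
qed

lemma transition_pgf_unique: "transition_pgf t \<eta> \<mu> \<Longrightarrow> 0 \<le> t \<Longrightarrow> transition t \<eta> = \<mu>"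
  using transition_pgf_transition[of t \<eta>] by (auto simp: transition_pgf_def intro!: pmf_eq_of_thinning)

lemma expectation_thinning_transition:
  "g \<in> {0..1} \<Longrightarrow> 0 \<le> t \<Longrightarrow>
    measure_pmf.expectation (transition t \<eta>) (thinning g) = thinning (P t g) \<eta> * exp (- (immigrants t \<bullet> g))"
  using transition_pgf_transition[of t \<eta>] by (simp add: transition_pgf_def)

lemma expectation_thinning_bind_transition:
  assumes "g \<in> {0..1}" "0 \<le> t"
  shows "measure_pmf.expectation (bind_pmf \<mu> (transition t)) (thinning g) =
    measure_pmf.expectation \<mu> (thinning (P t g)) * exp (- (immigrants t \<bullet> g))"
  by (subst expectation_bind[of _ 1])
    (use assms abs_thinning_le in \<open>auto simp: expectation_thinning_transition\<close>)

lemma transition_0: "transition 0 \<eta> = return_pmf \<eta>"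
  by (rule transition_pgf_unique) (simp_all add: transition_pgf_def)

text \<open>The immigration exponents match because symmetry moves \<open>P t\<close> from g onto
  \<open>immigrants s\<close>, after which \<open>immigrants_add\<close> applies.\<close>

lemma transition_add:
  assumes "0 \<le> s" "0 \<le> t"
  shows "transition (s + t) \<eta> = bind_pmf (transition s \<eta>) (transition t)"
proof (rule transition_pgf_unique)
  show "transition_pgf (s + t) \<eta> (bind_pmf (transition s \<eta>) (transition t))"
    unfolding transition_pgf_def
  proof
    fix g :: "real ^ 'v" assume g: "g \<in> {0..1}"
    show "measure_pmf.expectation (bind_pmf (transition s \<eta>) (transition t)) (thinning g) =
        thinning (P (s + t) g) \<eta> * exp (- (immigrants (s + t) \<bullet> g))"
      using assms g P_cube[OF g \<open>0 \<le> t\<close>]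
      by (simp add: expectation_thinning_bind_transition expectation_thinning_transition P_add
          immigrants_add inner_add_left P_inner[of t "immigrants s"] exp_add[symmetric])
  qed
qed (use assms in simp)

text \<open>The exponent <\<zeta>, P t g> equals <P t \<zeta>, g> by symmetry: the semigroup that
  moves the particles is also the one that moves the intensities.\<close>

lemma bind_poisson_product_transition:
  assumes "\<zeta> \<in> orthant" "0 \<le> t"
  shows "bind_pmf (poisson_product \<zeta>) (transition t) = poisson_product (flow \<zeta> t)"
proof (rule pmf_eq_of_thinning)
  fix g :: "real ^ 'v" assume g: "g \<in> {0..1}"
  show "measure_pmf.expectation (bind_pmf (poisson_product \<zeta>) (transition t)) (thinning g) =
      measure_pmf.expectation (poisson_product (flow \<zeta> t)) (thinning g)"
    using assms g P_cube[OF g \<open>0 \<le> t\<close>] flow_orthant[OF assms]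
    by (simp add: expectation_thinning_bind_transition expectation_thinning_poisson_product
        flow_eq inner_add_left P_inner[of t \<zeta>] exp_add[symmetric])
qed

text \<open>Under stationarity the generating function is the same at all times. In its formula
  \<open>P t g\<close> tends to 0, so the initial particles are forgotten and only the immigrants,
  with limiting intensity \<open>equilibrium\<close>, remain.\<close>

lemma stationary_transition_unique:
  assumes "\<And>t. 0 \<le> t \<Longrightarrow> bind_pmf \<mu> (transition t) = \<mu>"
  shows "\<mu> = poisson_product equilibrium"
proof (rule pmf_eq_of_thinning)
  fix g :: "real ^ 'v" assume g: "g \<in> {0..1}"
  let ?a = "\<lambda>n. measure_pmf.expectation \<mu> (thinning (P (real n) g)) * exp (- (immigrants (real n) \<bullet> g))"
  have seq: "(\<lambda>n. P (real n) g) \<longlonglongrightarrow> 0" "(\<lambda>n. immigrants (real n)) \<longlonglongrightarrow> equilibrium"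
    using filterlim_compose[OF P_tendsto_0 filterlim_real_sequentially]
      filterlim_compose[OF immigrants_tendsto filterlim_real_sequentially] by auto
  have "(\<lambda>n. measure_pmf.expectation \<mu> (thinning (P (real n) g))) \<longlonglongrightarrow> measure_pmf.expectation \<mu> (\<lambda>_. 1)"
  proof (rule integral_dominated_convergence[where w = "\<lambda>_. 1"])
    have "(\<lambda>n. thinning (P (real n) g) \<eta>) \<longlonglongrightarrow> (\<Prod>i\<in>UNIV. (1 - 0 $ i) ^ \<eta> i)" for \<eta>
      unfolding thinning_def by (intro tendsto_intros seq)
    then show "AE \<eta> in measure_pmf \<mu>. (\<lambda>n. thinning (P (real n) g) \<eta>) \<longlonglongrightarrow> 1" by simp
    show "AE \<eta> in measure_pmf \<mu>. norm (thinning (P (real n) g) \<eta>) \<le> 1" for n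
      using abs_thinning_le[OF P_cube[OF g, of "real n"]] by simp
  qed auto
  then have "?a \<longlonglongrightarrow> measure_pmf.expectation \<mu> (\<lambda>_. 1) * exp (- (equilibrium \<bullet> g))"
    by (intro tendsto_intros seq)
  moreover have "?a n = measure_pmf.expectation \<mu> (thinning g)" for n
    using assms[of "real n"] expectation_thinning_bind_transition[OF g, of "real n" \<mu>] by simp
  ultimately have "measure_pmf.expectation \<mu> (thinning g) = exp (- (equilibrium \<bullet> g))"
    by (simp add: LIMSEQ_const_iff)
  then show "measure_pmf.expectation \<mu> (thinning g) = measure_pmf.expectation (poisson_product equilibrium) (thinning g)"
    by (simp only: expectation_thinning_poisson_product[OF equilibrium_orthant g])
qed

section \<open>The generator of the constructed kernels\<close>

lemma P_deriv_component:
  "((\<lambda>t. P t x $ i) has_real_derivative drift x $ i) (at 0 within S)"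
  using bounded_linear.has_vector_derivative[OF bounded_linear_vec_nth[of i] has_vector_derivative_P[of x 0 S]]
  by (simp add: has_real_derivative_iff_has_vector_derivative)

text \<open>Row i of the one-particle generator, with \<open>None\<close> as cemetery; the entry at
  \<open>Some i\<close> is the diagonal one.\<close>

definition jump_rate :: "'v \<Rightarrow> 'v option \<Rightarrow> real" where
  "jump_rate i z = (case z of None \<Rightarrow> c i * \<gamma> i | Some j \<Rightarrow> if j = i then - killing_rate i else 2 * p i j)"

text \<open>The state space is finite, so all states are listed. Their rates sum to 0: what leaves i
  reappears at another vertex or in the cemetery.\<close>

lemma generates_particle:
  "generates (\<lambda>t. particle t i) (Some i) (\<lambda>f. \<Sum>z\<in>UNIV. jump_rate i z * f z)"
proof (rule generates_of_pmf_deriv[where y = id, simplified])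
  show "particle 0 i = return_pmf (Some i)"
    by (rule pmf_eqI) (auto simp: pmf_particle axis_def indicator_def split: option.split)
  have "((\<lambda>t. case_option (1 - P t 1 $ i) (\<lambda>j. P t (axis j 1) $ i) z) has_real_derivative jump_rate i z)
      (at 0 within {0..})" for z
  proof (cases z)
    case None
    have "((\<lambda>t. 1 - P t 1 $ i) has_real_derivative 0 - drift 1 $ i) (at 0 within {0..})"
      by (intro DERIV_diff DERIV_const P_deriv_component)
    then show ?thesis by (simp add: None jump_rate_def drift_def)
  next
    case (Some j)
    have "(\<Sum>k\<in>UNIV - {i}. 2 * p i k * (axis j 1 $ k)) = (if j = i then 0 else 2 * p i j)"
      by (auto simp: axis_def if_distrib[of "\<lambda>x. _ * x"] cong: if_cong)
    then have "drift (axis j 1) $ i = jump_rate i (Some j)"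
      by (auto simp: drift_def jump_rate_def killing_rate_def axis_def right_diff_distrib sum_subtractf sum_negf)
    then show ?thesis using P_deriv_component[of "axis j 1" i] by (simp add: Some)
  qed
  then show "((\<lambda>t. pmf (particle t i) z) has_real_derivative jump_rate i z) (at 0 within {0..})" for z
    by (rule has_field_derivative_transform_within[where d = 1]) (auto simp: pmf_particle)
  have "(\<Sum>j\<in>UNIV. jump_rate i (Some j)) = jump_rate i (Some i) + (\<Sum>j\<in>UNIV - {i}. jump_rate i (Some j))"
    by (rule sum.remove) auto
  also have "(\<Sum>j\<in>UNIV - {i}. jump_rate i (Some j)) = (\<Sum>j\<in>UNIV - {i}. 2 * p i j)"
    by (rule sum.cong) (auto simp: jump_rate_def)
  finally show "(\<Sum>z\<in>UNIV. jump_rate i z) = 0"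
    by (simp add: sum_option) (simp add: jump_rate_def killing_rate_def)
qed auto

text \<open>The empty and the one-particle configurations, the only ones that matter to first order
  in t.\<close>

lemma pmf_poisson_product_low:
  assumes "\<zeta> \<in> orthant"
  shows "pmf (poisson_product \<zeta>) (settle z (\<lambda>_. 0)) =
    case_option 1 (\<lambda>i. \<zeta> $ i) z * exp (- (\<Sum>i\<in>UNIV. \<zeta> $ i))"
proof -
  have "pmf (poisson_product \<zeta>) (settle z (\<lambda>_. 0)) =
      (\<Prod>i\<in>UNIV. \<zeta> $ i ^ settle z (\<lambda>_. 0) i / fact (settle z (\<lambda>_. 0) i)) * (\<Prod>i\<in>UNIV. exp (- \<zeta> $ i))"
    by (simp only: pmf_poisson_product[OF assms] prod.distrib)
  also have "(\<Prod>i\<in>UNIV. \<zeta> $ i ^ settle z (\<lambda>_. 0) i / fact (settle z (\<lambda>_. 0) i)) = case_option 1 (\<lambda>i. \<zeta> $ i) z"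
    by (cases z) (simp_all add: prod.remove[OF finite UNIV_I, of _ "the z"])
  finally show ?thesis by (simp add: exp_sum flip: sum_negf)
qed

lemma generates_immigrants:
  "generates (\<lambda>t. poisson_product (immigrants t)) (\<lambda>_. 0)
    (\<lambda>f. \<Sum>i\<in>UNIV. source $ i * (f ((\<lambda>_. 0)(i := 1)) - f (\<lambda>_. 0)))"
proof -
  define q where "q = case_option (- (\<Sum>i\<in>UNIV. source $ i)) (\<lambda>i. source $ i)"
  have m: "((\<lambda>t. immigrants t $ i) has_real_derivative source $ i) (at 0 within {0..})" for i
  proof -
    have "((\<lambda>t. equilibrium $ i - P t equilibrium $ i) has_real_derivative 0 - drift equilibrium $ i) (at 0 within {0..})"
      by (intro DERIV_diff DERIV_const P_deriv_component)
    then show ?thesis by (simp add: immigrants_def drift_equilibrium)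
  qed
  have e: "((\<lambda>t. exp (- (\<Sum>i\<in>UNIV. immigrants t $ i))) has_real_derivative - (\<Sum>i\<in>UNIV. source $ i)) (at 0 within {0..})"
    by (rule derivative_eq_intros m refl)+ simp
  have "generates (\<lambda>t. poisson_product (immigrants t)) (settle None (\<lambda>_. 0))
      (\<lambda>f. \<Sum>z\<in>UNIV. q z * f (settle z (\<lambda>_. 0)))"
  proof (rule generates_of_pmf_deriv)
    show "inj_on (\<lambda>z. settle z (\<lambda>_::'v. 0)) UNIV"
      by (auto simp: inj_on_def settle_def fun_eq_iff split: option.splits if_splits)
    \<comment> \<open>The Poisson product with zero intensities is recognized as a point mass
      through its generating function.\<close>
    have "transition 0 (\<lambda>_. 0) = poisson_product (immigrants 0)"
      by (rule transition_pgf_unique[OF transition_pgf_zero]) auto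
    then show "poisson_product (immigrants 0) = return_pmf (settle None (\<lambda>_. 0))"
      by (simp add: transition_0)
    have "((\<lambda>t. case_option 1 (\<lambda>i. immigrants t $ i) z * exp (- (\<Sum>i\<in>UNIV. immigrants t $ i))) has_real_derivative q z)
        (at 0 within {0..})" for z
    proof (cases z)
      case (Some i)
      show ?thesis using DERIV_mult[OF m[of i] e] by (simp add: Some q_def)
    qed (use e in \<open>simp add: q_def\<close>)
    then show "((\<lambda>t. pmf (poisson_product (immigrants t)) (settle z (\<lambda>_. 0))) has_real_derivative q z) (at 0 within {0..})" for z
      by (rule has_field_derivative_transform_within[where d = 1])
        (auto simp: pmf_poisson_product_low immigrants_orthant)
    show "sum q UNIV = 0" by (simp add: sum_option q_def)
  qed auto
  then have "generates (\<lambda>t. poisson_product (immigrants t)) (\<lambda>_. 0) (\<lambda>f. \<Sum>z\<in>UNIV. q z * f (settle z (\<lambda>_. 0)))"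
    by (simp only: settle_simps)
  then show ?thesis
    by (rule generates_cong)
      (simp_all add: sum_option q_def right_diff_distrib sum_subtractf sum_distrib_right)
qed

text \<open>What a single particle sitting at i contributes to \<open>L f \<eta>\<close>.\<close>

definition jump_term :: "'v \<Rightarrow> (('v \<Rightarrow> nat) \<Rightarrow> real) \<Rightarrow> ('v \<Rightarrow> nat) \<Rightarrow> real" where
  "jump_term i f \<eta> = (\<Sum>j\<in>UNIV - {i}. 2 * p i j * (f (\<eta>(i := \<eta> i - 1, j := \<eta> j + 1)) - f \<eta>)) +
    c i * \<gamma> i * (f (\<eta>(i := \<eta> i - 1)) - f \<eta>)"

lemma walk_gen_eq:
  "L f \<eta> = (\<Sum>i\<in>UNIV. real (\<eta> i) * jump_term i f \<eta>) +
    (\<Sum>i\<in>UNIV. source $ i * (f (\<eta>(i := \<eta> i + 1)) - f \<eta>))"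
proof -
  define F where "F i j = p i j * (real (\<eta> i) * (f (\<eta>(i := \<eta> i - 1, j := \<eta> j + 1)) - f \<eta>))" for i j
  have edge: "p i j * walk_edge i j f \<eta> = F i j + F j i" if "i \<noteq> j" for i j
  proof -
    have "\<eta>(i := \<eta> i + 1, j := \<eta> j - 1) = \<eta>(j := \<eta> j - 1, i := \<eta> i + 1)"
      using that by (rule fun_upd_twist)
    then show ?thesis by (simp only: walk_edge_def F_def p_sym[of j i] distrib_left)
  qed
  have "(\<Sum>i\<in>UNIV. \<Sum>j\<in>UNIV - {i}. p i j * walk_edge i j f \<eta>) =
      (\<Sum>i\<in>UNIV. \<Sum>j\<in>UNIV - {i}. F i j) + (\<Sum>i\<in>UNIV. \<Sum>j\<in>UNIV - {i}. F j i)"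
    by (simp add: edge flip: sum.distrib)
  also have "(\<Sum>i\<in>UNIV. \<Sum>j\<in>UNIV - {i}. F j i) = (\<Sum>i\<in>UNIV. \<Sum>j\<in>UNIV - {i}. F i j)"
    by (rule sum_offdiag_swap)
  finally show ?thesis
    by (simp add: walk_gen_def walk_site_def jump_term_def source_def F_def sum_distrib_left distrib_left sum.distrib mult_ac flip: mult_2)
qed

lemma jump_term_add:
  assumes "\<eta>' = \<eta>(i := \<eta> i + 1)"
  shows "real (\<eta>' k) * jump_term k f \<eta>' = real (\<eta> k) * jump_term k (\<lambda>x. f (x(i := x i + 1))) \<eta> +
    (if k = i then \<Sum>z\<in>UNIV. jump_rate i z * f (settle z \<eta>) else 0)"
proof (cases "k = i")
  case True
  have "(\<Sum>z\<in>UNIV. jump_rate i z * f (settle z \<eta>)) = jump_term i f \<eta>'"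
  proof -
    have "(\<Sum>j\<in>UNIV. jump_rate i (Some j) * f (\<eta>(j := \<eta> j + 1))) =
        - killing_rate i * f \<eta>' + (\<Sum>j\<in>UNIV - {i}. 2 * p i j * f (\<eta>(j := \<eta> j + 1)))"
      by (simp add: sum.remove[OF finite UNIV_I, of _ i] jump_rate_def assms)
    moreover have "jump_term i f \<eta>' = (\<Sum>j\<in>UNIV - {i}. 2 * p i j * (f (\<eta>(j := \<eta> j + 1)) - f \<eta>')) + c i * \<gamma> i * (f \<eta> - f \<eta>')"
      unfolding jump_term_def by (intro arg_cong2[of _ _ _ _ "(+)"] sum.cong) (auto simp: assms)
    ultimately show ?thesis
      by (simp add: sum_option jump_rate_def[of i None] killing_rate_def right_diff_distrib sum_subtractf
          sum_distrib_right sum_distrib_left algebra_simps)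
  qed
  moreover have "real (\<eta> i) * jump_term i (\<lambda>x. f (x(i := x i + 1))) \<eta> = real (\<eta> i) * jump_term i f \<eta>'"
  \<comment> \<open>For \<eta> i = 0 the truncated subtraction spoils the equality of the jump
    terms, but their weight is 0.\<close>
  proof (cases "\<eta> i")
    case (Suc n)
    have "jump_term i (\<lambda>x. f (x(i := x i + 1))) \<eta> = jump_term i f \<eta>'"
      unfolding jump_term_def using Suc
      by (intro arg_cong2[of _ _ _ _ "(+)"] sum.cong refl) (auto simp: assms fun_upd_twist intro!: arg_cong[of _ _ f])
    then show ?thesis by simp
  qed simp
  ultimately show ?thesis using True by (auto simp: assms distrib_right)
next
  case False
  have "jump_term k f \<eta>' = jump_term k (\<lambda>x. f (x(i := x i + 1))) \<eta>"
    unfolding jump_term_def using False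
    by (intro arg_cong2[of _ _ _ _ "(+)"] sum.cong refl arg_cong2[of _ _ _ _ "(*)"] arg_cong2[of _ _ _ _ "(-)"] arg_cong[of _ _ f])
      (auto simp: assms fun_eq_iff)
  then show ?thesis using False by (simp add: assms)
qed

text \<open>Independence at the level of generators: either the new particle moves and the others
  rest, or it stays at i while \<open>L\<close> acts on the others. This is the sum that
  \<open>generates_pair\<close> produces.\<close>

lemma walk_gen_add:
  "L f (\<eta>(i := \<eta> i + 1)) =
    (\<Sum>z\<in>UNIV. jump_rate i z * f (settle z \<eta>)) + L (\<lambda>x. f (x(i := x i + 1))) \<eta>"
proof -
  define \<eta>' where "\<eta>' = \<eta>(i := \<eta> i + 1)"
  have "f (\<eta>'(k := \<eta>' k + 1)) = f ((\<eta>(k := \<eta> k + 1))(i := (\<eta>(k := \<eta> k + 1)) i + 1))" for k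
    by (rule arg_cong[of _ _ f]) (auto simp: \<eta>'_def)
  then show ?thesis
    unfolding \<eta>'_def[symmetric] walk_gen_eq[of f \<eta>'] walk_gen_eq[of _ \<eta>] jump_term_add[OF \<eta>'_def]
    by (simp add: sum.distrib)
qed

lemma generates_transition: "generates (\<lambda>t. transition t \<eta>) \<eta> (\<lambda>f. L f \<eta>)"
proof (induction \<eta> rule: configuration_induct)
  case zero
  show ?case
    by (rule generates_cong[OF generates_immigrants])
      (auto simp: transition_pgf_unique[OF transition_pgf_zero] walk_gen_eq)
next
  case (add \<eta> i)
  have "generates (\<lambda>t. map_pmf (case_prod settle) (pair_pmf (particle t i) (transition t \<eta>))) (\<eta>(i := \<eta> i + 1))
      (\<lambda>f. (\<Sum>z\<in>UNIV. jump_rate i z * f (settle z \<eta>)) + L (\<lambda>x. f (x(i := x i + 1))) \<eta>)"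
    using generates_map[OF generates_pair[OF generates_particle add], of "case_prod settle"] by simp
  then show ?case
  proof (rule generates_cong)
    show "transition t (\<eta>(i := \<eta> i + 1)) = map_pmf (case_prod settle) (pair_pmf (particle t i) (transition t \<eta>))"
      if "0 \<le> t" for t
      by (rule transition_pgf_unique[OF transition_pgf_add[OF that transition_pgf_transition[OF that]] that])
  qed (rule walk_gen_add)
qed

theorem markov_semigroup_transition: "markov_semigroup_of L transition"
  unfolding markov_semigroup_of_def
proof (intro conjI allI impI)
  fix f :: "('v \<Rightarrow> nat) \<Rightarrow> real" and \<eta>
  assume "bounded (range f)"
  then obtain C where "\<And>y. \<bar>f y\<bar> \<le> C" by (auto simp: bounded_iff)
  then show "((\<lambda>t. measure_pmf.expectation (transition t \<eta>) f) has_real_derivative L f \<eta>) (at 0 within {0..})"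
    by (rule generatesD(2)[OF generates_transition])
qed (auto simp: transition_0 transition_add)

end

theorem theorem4p2:
  fixes p :: "'v::finite \<Rightarrow> 'v \<Rightarrow> real"
    and c \<alpha> \<gamma> :: "'v \<Rightarrow> real"
  assumes "\<And>i j. p i j \<ge> 0"
    and "\<And>i j. p i j = p j i"
    and "\<And>i j. (i, j) \<in> {(a, b). p a b > 0}\<^sup>*"
    and "\<And>i. c i \<ge> 0"
    and "\<exists>i. c i > 0"
    and "\<And>i. \<alpha> i \<ge> 0"
    and "\<And>i. \<gamma> i > 0"
  shows "poisson_intertwined (walk_gen p c \<alpha> \<gamma>) (det_gen p c \<alpha> \<gamma>) \<and>
    (\<exists>S. markov_semigroup_of (walk_gen p c \<alpha> \<gamma>) S) \<and>
    (\<exists>Z. deterministic_flow_of (det_gen p c \<alpha> \<gamma>) Z) \<and>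
    (\<forall>S Z. markov_semigroup_of (walk_gen p c \<alpha> \<gamma>) S \<longrightarrow>
       deterministic_flow_of (det_gen p c \<alpha> \<gamma>) Z \<longrightarrow>
       (\<forall>\<zeta>\<in>orthant. \<forall>t\<ge>0.
          bind_pmf (poisson_product \<zeta>) (S t) = poisson_product (Z \<zeta> t)) \<and>
       (\<exists>!\<zeta>. fixed_point Z \<zeta>) \<and>
       (\<forall>\<zeta>. fixed_point Z \<zeta> \<longrightarrow>
          (\<forall>\<mu>. stationary S \<mu> \<longleftrightarrow> \<mu> = poisson_product \<zeta>)))"
proof -
  interpret boundary_walk p c \<alpha> \<gamma> by unfold_locales (use assms in auto)
  have "(\<forall>\<zeta>\<in>orthant. \<forall>t\<ge>0. bind_pmf (poisson_product \<zeta>) (S t) = poisson_product (Z \<zeta> t)) \<and>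
      (\<exists>!\<zeta>. fixed_point Z \<zeta>) \<and>
      (\<forall>\<zeta>. fixed_point Z \<zeta> \<longrightarrow> (\<forall>\<mu>. stationary S \<mu> \<longleftrightarrow> \<mu> = poisson_product \<zeta>))"
    if S: "markov_semigroup_of L S" and Z: "deterministic_flow_of (det_gen p c \<alpha> \<gamma>) Z" for S Z
  proof -
    have ST: "S t = transition t" if "0 \<le> t" for t
      using markov_semigroup_unique[OF S markov_semigroup_transition that] by auto
    have propagate: "bind_pmf (poisson_product \<zeta>) (S t) = poisson_product (Z \<zeta> t)" if "\<zeta> \<in> orthant" "0 \<le> t" for \<zeta> t
      using that by (simp add: ST bind_poisson_product_transition deterministic_flow_unique[OF Z])
    have "stationary S \<mu> \<longleftrightarrow> \<mu> = poisson_product equilibrium" for \<mu>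
    proof
      assume "stationary S \<mu>"
      then show "\<mu> = poisson_product equilibrium"
        by (intro stationary_transition_unique) (simp add: stationary_def flip: ST)
    next
      assume "\<mu> = poisson_product equilibrium"
      moreover have "fixed_point Z equilibrium" by (simp add: fixed_point_iff[OF Z])
      ultimately show "stationary S \<mu>"
        using propagate[OF equilibrium_orthant] by (simp add: stationary_def fixed_point_def)
    qed
    with propagate show ?thesis by (simp add: fixed_point_iff[OF Z])
  qed
  then show ?thesis
    using poisson_intertwined_walk markov_semigroup_transition flow_is_deterministic_flow by blast
qed

end
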